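(* Let $v$ and $k$ be positive integers. Then there exists a Gorenstein simplex $\Delta\subset\mathbb{R}^d$ of some dimension $d$ whose $\delta$-polynomial is $1+t^{k}+t^{2k}+\cdots+t^{(v-1)k}$. Furthermore, if $\Delta\subset\mathbb{R}^d$ is any Gorenstein simplex of dimension $d$ with $\delta(\Delta,t)=1+t^{k}+t^{2k}+\cdots+t^{(v-1)k}$ which is not a lattice pyramid over any lower-dimensional lattice simplex, then $$vk-1\le d\le 4(v-1)k-2,$$ and the lower bound is attained (i.e. $d=vk-1$) if and only if $\Lambda_\Delta$ is generated by $(1/v,\ldots,1/v)\in(\mathbb{R}/\mathbb{Z})^{d+1}$.
   Context: A lattice polytope is a convex polytope in $\mathbb{R}^d$ all of whose vertices lie in $\mathbb{Z}^d$; a lattice simplex is a lattice polytope that is a simplex. For a $d$-dimensional lattice polytope $\mathcal{P}\subset\mathbb{R}^d$, its $\delta$-polynomial ($h^*$-polynomial) $\delta(\mathcal{P},t)$ is defined by $(1-t)^{d+1}\left(1+\sum_{n\ge1}|n\mathcal{P}\cap\mathbb{Z}^d|\,t^n\right)=\delta(\mathcal{P},t)$. Two $d$-dimensional lattice polytopes $\mathcal{P},\mathcal{Q}\subset\mathbb{R}^d$ are unimodularly equivalent if $\mathcal{Q}=f_U(\mathcal{P})+\mathbf{w}$ for some $\mathbf{w}\in\mathbb{Z}^d$ and some $U\in\mathbb{Z}^{d\times d}$ with $\det U=\pm1$, where $f_U(\mathbf{v})=\mathbf{v}U$. A $d$-dimensional lattice polytope is reflexive if the origin is in its interior and its dual polytope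 is again a lattice polytope; $\mathcal{P}$ is Gorenstein if for some positive integer $r$ the polytope $r\mathcal{P}$ is unimodularly equivalent to a reflexive polytope (equivalently, $\delta(\mathcal{P},t)=\delta_0+\cdots+\delta_st^s$ with $\delta_s\ne0$ is palindromic). For a $d$-dimensional lattice simplex $\Delta\subset\mathbb{R}^d$ with vertices $\mathbf{v}_0,\ldots,\mathbf{v}_d$, set $\Lambda_\Delta=\{(\lambda_0,\ldots,\lambda_d)\in(\mathbb{R}/\mathbb{Z})^{d+1}:\sum_{i=0}^d\lambda_i(\mathbf{v}_i,1)\in\mathbb{Z}^{d+1}\}$, a finite abelian group under componentwise addition. The lattice pyramid over a $d$-dimensional lattice polytope $\mathcal{P}$ is $\mathrm{Pyr}(\mathcal{P})=\mathrm{conv}(\mathcal{P}\times\{0\},(0,\ldots,0,1))\subset\mathbb{R}^{d+1}$. A lattice simplex is called a lattice pyramid (over a lower-dimensional lattice simplex) if it is, up to unimodular equivalence, obtained by successively taking lattice pyramids; equivalently, there is $i\in\{0,\ldots,d\}$ with $\lambda_i=0$ for all $(\lambda_0,\ldots,\lambda_d)\in\Lambda_\Delta$. In accordance with this criterion, a single point ($d=0$) is regarded as a lattice pyramid. *)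

theory Defs
  imports
    "Jordan_Normal_Form.Determinant"
    "HOL-Algebra.Product_Groups"
    "HOL-Computational_Algebra.Polynomial_FPS"
begin

text \<open>
  Euclidean space of dimension d is \<^term>\<open>carrier_vec d :: real vec set\<close>, so that the
  dimension can be quantified over and pyramids can raise it.
\<close>

definition lattice_vecs :: "nat \<Rightarrow> real vec set" where
  "lattice_vecs d = {x \<in> carrier_vec d. \<forall>j<d. x $ j \<in> \<int>}"

definition conv :: "nat \<Rightarrow> real vec set \<Rightarrow> real vec set" where
  "conv d S = {vec d (\<lambda>j. \<Sum>p\<in>F. c p * p $ j) | F c.
     finite F \<and> F \<subseteq> S \<and> (\<forall>p\<in>F. 0 \<le> c p) \<and> sum c F = (1 :: real)}"

definition interior_pts :: "nat \<Rightarrow> real vec set \<Rightarrow> real vec set" where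
  "interior_pts d S = {x \<in> carrier_vec d. \<exists>\<epsilon>>0. \<forall>y\<in>carrier_vec d.
     (y - x) \<bullet> (y - x) < \<epsilon>\<^sup>2 \<longrightarrow> y \<in> S}"

definition dilate :: "nat \<Rightarrow> real vec set \<Rightarrow> real vec set" where
  "dilate n P = (\<lambda>x. real n \<cdot>\<^sub>v x) ` P"

definition is_polytope :: "nat \<Rightarrow> real vec set \<Rightarrow> bool" where
  "is_polytope d P \<longleftrightarrow> (\<exists>V. finite V \<and> V \<noteq> {} \<and> V \<subseteq> carrier_vec d \<and> P = conv d V)"

text \<open>The vertices of a polytope are its extreme points.\<close>

definition vertices :: "real vec set \<Rightarrow> real vec set" where
  "vertices P = {x \<in> P. \<forall>a\<in>P. \<forall>b\<in>P. \<forall>u. 0 < u \<and> u < 1 \<and> a \<noteq> b \<longrightarrow>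
     x \<noteq> (1 - u) \<cdot>\<^sub>v a + u \<cdot>\<^sub>v b}"

definition lattice_polytope :: "nat \<Rightarrow> real vec set \<Rightarrow> bool" where
  "lattice_polytope d P \<longleftrightarrow> is_polytope d P \<and> vertices P \<subseteq> lattice_vecs d"

text \<open>
  A d-dimensional lattice simplex is given by an enumeration of its d + 1 affinely independent
  vertices; only the values at indices up to d matter.
\<close>

definition lattice_simplex :: "nat \<Rightarrow> (nat \<Rightarrow> real vec) \<Rightarrow> bool" where
  "lattice_simplex d vs \<longleftrightarrow> (\<forall>i\<le>d. vs i \<in> lattice_vecs d) \<and>
     (\<forall>c :: nat \<Rightarrow> real. (\<Sum>i\<le>d. c i) = 0 \<and> vec d (\<lambda>j. \<Sum>i\<le>d. c i * vs i $ j) = 0\<^sub>v d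
        \<longrightarrow> (\<forall>i\<le>d. c i = 0))"

definition simplex :: "nat \<Rightarrow> (nat \<Rightarrow> real vec) \<Rightarrow> real vec set" where
  "simplex d vs = conv d (vs ` {..d})"

definition ehrhart_series :: "nat \<Rightarrow> real vec set \<Rightarrow> int fps" where
  "ehrhart_series d P =
     Abs_fps (\<lambda>n. if n = 0 then 1 else int (card (dilate n P \<inter> lattice_vecs d)))"

definition has_delta_polynomial :: "nat \<Rightarrow> real vec set \<Rightarrow> int poly \<Rightarrow> bool" where
  "has_delta_polynomial d P \<delta> \<longleftrightarrow>
     (1 - fps_X) ^ (d + 1) * ehrhart_series d P = fps_of_poly \<delta>"

text \<open>The map is v to vU on row vectors, that is, the transpose of U applied to a column vector.\<close>

definition unimodularly_equivalent :: "nat \<Rightarrow> real vec set \<Rightarrow> real vec set \<Rightarrow> bool" where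
  "unimodularly_equivalent d P Q \<longleftrightarrow>
     (\<exists>(U :: int mat) w. U \<in> carrier_mat d d \<and> det U \<in> {1, -1} \<and> w \<in> lattice_vecs d \<and>
        Q = (\<lambda>x. transpose_mat (map_mat real_of_int U) *\<^sub>v x + w) ` P)"

definition dual_polytope :: "nat \<Rightarrow> real vec set \<Rightarrow> real vec set" where
  "dual_polytope d P = {y \<in> carrier_vec d. \<forall>x\<in>P. y \<bullet> x \<le> 1}"

definition reflexive_polytope :: "nat \<Rightarrow> real vec set \<Rightarrow> bool" where
  "reflexive_polytope d P \<longleftrightarrow>
     lattice_polytope d P \<and> 0\<^sub>v d \<in> interior_pts d P \<and> lattice_polytope d (dual_polytope d P)"

definition gorenstein :: "nat \<Rightarrow> real vec set \<Rightarrow> bool" where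
  "gorenstein d P \<longleftrightarrow>
     (\<exists>r>0. \<exists>Q. reflexive_polytope d Q \<and> unimodularly_equivalent d (dilate r P) Q)"

definition pyr :: "nat \<Rightarrow> real vec set \<Rightarrow> real vec set" where
  "pyr d P = conv (d + 1) ((\<lambda>x. x @\<^sub>v 0\<^sub>v 1) ` P \<union> {unit_vec (d + 1) d})"

primrec iterated_pyr :: "nat \<Rightarrow> nat \<Rightarrow> real vec set \<Rightarrow> real vec set" where
  "iterated_pyr e 0 P = P"
| "iterated_pyr e (Suc m) P = pyr (e + m) (iterated_pyr e m P)"

text \<open>The disjunct d = 0 is a convention: it matches the criterion that some coordinate vanishes on all of Lambda.\<close>

definition lattice_pyramid :: "nat \<Rightarrow> real vec set \<Rightarrow> bool" where
  "lattice_pyramid d P \<longleftrightarrow> d = 0 \<or>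
     (\<exists>e<d. \<exists>ws. lattice_simplex e ws \<and>
        unimodularly_equivalent d (iterated_pyr e (d - e) (simplex e ws)) P)"

definition real_group :: "real monoid" where
  "real_group = \<lparr>carrier = UNIV, monoid.mult = (+), one = 0\<rparr>"

definition real_mod_int :: "real set monoid" where
  "real_mod_int = real_group Mod \<int>"

definition mod_int :: "real \<Rightarrow> real set" where
  "mod_int x = \<int> #>\<^bsub>real_group\<^esub> x"

definition torus :: "nat \<Rightarrow> (nat \<Rightarrow> real set) monoid" where
  "torus n = product_group {..<n} (\<lambda>_. real_mod_int)"

text \<open>
  The lattice condition does not depend on the choice of the real representatives, since the
  vertices are lattice points.
\<close>

definition Lambda :: "nat \<Rightarrow> (nat \<Rightarrow> real vec) \<Rightarrow> (nat \<Rightarrow> real set) set" where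
  "Lambda d vs = {(\<lambda>i\<in>{..<d + 1}. mod_int (l i)) | l :: nat \<Rightarrow> real.
     vec (d + 1) (\<lambda>j. \<Sum>i\<le>d. l i * (vs i @\<^sub>v vec 1 (\<lambda>_. 1)) $ j) \<in> lattice_vecs (d + 1)}"

end

theory Submission imports Defs begin

text \<open>
  Let \<open>v\<^sub>0, \<dots>, v\<^sub>d\<close> be the vertices of a lattice simplex. Splitting the coefficients of a lattice
  point of the cone over the simplex into integral and fractional parts shows that the
  \<open>\<delta>\<close>-polynomial is the sum of \<open>t\<close> to the power \<open>ht(\<lambda>)\<close> over \<open>\<lambda> \<in> \<Lambda>\<close>, where \<open>ht(\<lambda>)\<close> is the sum
  of the representatives in \<open>[0,1)\<close> of the coordinates of \<open>\<lambda>\<close> (theorem \<open>ehrhart_series_simplex\<close>). Hence a simplex has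
  \<open>\<delta>\<close>-polynomial \<open>1 + t\<^sup>k + \<dots> + t\<^sup>(\<^sup>v\<^sup>-\<^sup>1\<^sup>)\<^sup>k\<close> if and only if \<open>\<Lambda>\<close> has \<open>v\<close> elements, of heights
  \<open>0, k, \<dots>, (v - 1) k\<close>. What remains is arithmetic in the finite group \<open>\<Lambda>\<close>.

  Lower bound and equality case. Since \<open>\<Lambda>\<close> has order \<open>v\<close>, each coordinate of an element of \<open>\<Lambda>\<close> is a
  multiple of \<open>1/v\<close> and so at most \<open>1 - 1/v\<close>. The element of largest height gives
  \<open>(v - 1) k \<le> (d + 1) (1 - 1/v)\<close>, that is, \<open>v k \<le> d + 1\<close>. Equality forces this element to be
  \<open>(1 - 1/v, \<dots>, 1 - 1/v)\<close>, the negative of \<open>(1/v, \<dots>, 1/v)\<close>, which then generates \<open>\<Lambda>\<close> because it has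
  order \<open>v\<close>. Conversely, if \<open>(1/v, \<dots>, 1/v)\<close> lies in \<open>\<Lambda>\<close>, its negative has height \<open>(d + 1) (1 - 1/v)\<close>,
  and this is at most the largest height \<open>(v - 1) k\<close>. These arguments divide by \<open>v - 1\<close>; for \<open>v = 1\<close>
  the group is trivial, so that the simplex is a lattice pyramid.

  Upper bound. If the simplex is not a lattice pyramid, every coordinate is nonzero on some element
  of \<open>\<Lambda>\<close> (theorem \<open>lattice_pyramid_if_coordinate_vanishes\<close>), hence on at least half of them. As \<open>\<lambda>\<close> and \<open>-\<lambda>\<close> contribute \<open>1\<close>
  together whenever the coordinate of \<open>\<lambda>\<close> is nonzero, the coordinate sums to at least \<open>v/4\<close> over \<open>\<Lambda>\<close>.
  The heights add up to \<open>k v (v - 1) / 2\<close>, so \<open>(d + 1) v / 4 \<le> k v (v - 1) / 2\<close>. This yields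
  \<open>d + 1 \<le> 2 (v - 1) k\<close>, which implies the stated bound.

  Existence. For \<open>d + 1 = v k\<close>, take the vertices \<open>e\<^sub>0, \<dots>, e\<^sub>(\<^sub>d\<^sub>-\<^sub>2\<^sub>)\<close>, the point
  \<open>v e\<^sub>(\<^sub>d\<^sub>-\<^sub>1\<^sub>) - e\<^sub>0 - \<dots> - e\<^sub>(\<^sub>d\<^sub>-\<^sub>2\<^sub>)\<close> and the origin. The group \<open>\<Lambda>\<close> is generated by \<open>(1/v, \<dots>, 1/v)\<close>, and
  the \<open>k\<close>-th dilate, translated so that its barycentre becomes the origin, is reflexive.
\<close>

section \<open>Simplices, convex combinations and affine maps\<close>

definition comb :: "nat \<Rightarrow> (nat \<Rightarrow> real vec) \<Rightarrow> (nat \<Rightarrow> real) \<Rightarrow> real vec" where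
  "comb d vs c = vec d (\<lambda>j. \<Sum>i\<le>d. c i * vs i $ j)"

lemma comb_carrier [simp]: "comb d vs c \<in> carrier_vec d" "dim_vec (comb d vs c) = d"
  by (simp_all add: comb_def)

lemma comb_index [simp]: "j < d \<Longrightarrow> comb d vs c $ j = (\<Sum>i\<le>d. c i * vs i $ j)"
  by (simp add: comb_def)

text \<open>
  Weights indexed by the vertices instead of by a finite set of points. If the enumeration repeats a
  vertex, the weight of that point is the sum of the weights of its indices.
\<close>

lemma simplex_eq_combinations:
  "simplex d vs = {comb d vs c | c. (\<forall>i\<le>d. 0 \<le> c i) \<and> (\<Sum>i\<le>d. c i) = 1}"
proof (intro Set.set_eqI iffI)
  fix x assume "x \<in> simplex d vs"
  then obtain F c where F: "finite F" "F \<subseteq> vs ` {..d}" and c: "\<forall>p\<in>F. 0 \<le> c p" "sum c F = (1::real)"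
    and x: "x = vec d (\<lambda>j. \<Sum>p\<in>F. c p * p $ j)"
    unfolding simplex_def conv_def by auto
  obtain g where g: "\<And>p. p \<in> F \<Longrightarrow> g p \<le> d \<and> vs (g p) = p"
  proof -
    have "\<forall>p\<in>F. \<exists>i. i \<le> d \<and> vs i = p" using F by force
    then show thesis using that by metis
  qed
  have inj: "inj_on g F" by (metis g inj_onI)
  define c' where "c' i = (if i \<in> g ` F then c (vs i) else 0)" for i
  have red: "(\<Sum>i\<le>d. c' i * h i) = (\<Sum>p\<in>F. c p * h (g p))" for h :: "nat \<Rightarrow> real"
  proof -
    have "(\<Sum>i\<le>d. c' i * h i) = (\<Sum>i\<in>g ` F. c (vs i) * h i)"
      by (rule sum.mono_neutral_cong_right) (use g in \<open>auto simp: c'_def\<close>)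
    also have "\<dots> = (\<Sum>p\<in>F. c p * h (g p))"
      by (subst sum.reindex[OF inj]) (use g in \<open>auto intro!: sum.cong\<close>)
    finally show ?thesis .
  qed
  have "x = comb d vs c'"
    unfolding x comb_def red by (intro eq_vecI) (use g in \<open>auto intro!: sum.cong\<close>)
  moreover have "(\<Sum>i\<le>d. c' i) = 1" using red[of "\<lambda>_. 1"] c by simp
  moreover have "\<forall>i\<le>d. 0 \<le> c' i" using c g by (auto simp: c'_def)
  ultimately show "x \<in> {comb d vs c | c. (\<forall>i\<le>d. 0 \<le> c i) \<and> (\<Sum>i\<le>d. c i) = 1}" by blast
next
  fix x assume "x \<in> {comb d vs c | c. (\<forall>i\<le>d. 0 \<le> c i) \<and> (\<Sum>i\<le>d. c i) = 1}"
  then obtain c where c: "\<forall>i\<le>d. 0 \<le> c i" "(\<Sum>i\<le>d. c i) = 1" and x: "x = comb d vs c" by auto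
  \<comment> \<open>The sum over the fibre handles repeated vertices.\<close>
  define c' where "c' p = (\<Sum>i\<in>{i\<in>{..d}. vs i = p}. c i)" for p
  have red: "(\<Sum>p\<in>vs ` {..d}. c' p * h p) = (\<Sum>i\<le>d. c i * h (vs i))" for h :: "real vec \<Rightarrow> real"
  proof -
    have "(\<Sum>i\<le>d. c i * h (vs i)) = (\<Sum>p\<in>vs ` {..d}. \<Sum>i\<in>{i\<in>{..d}. vs i = p}. c i * h (vs i))"
      by (rule sum.image_gen) simp
    also have "\<dots> = (\<Sum>p\<in>vs ` {..d}. c' p * h p)"
      unfolding c'_def sum_distrib_right by (intro sum.cong refl) auto
    finally show ?thesis by simp
  qed
  show "x \<in> simplex d vs"
    unfolding simplex_def conv_def
  proof (intro CollectI exI conjI)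
    show "x = vec d (\<lambda>j. \<Sum>p\<in>vs ` {..d}. c' p * p $ j)"
      unfolding x comb_def red by simp
    show "sum c' (vs ` {..d}) = 1" using red[of "\<lambda>_. 1"] c by simp
    show "\<forall>p\<in>vs ` {..d}. 0 \<le> c' p" using c by (auto simp: c'_def intro!: sum_nonneg)
  qed auto
qed

lemma conv_mono: "S \<subseteq> T \<Longrightarrow> conv d S \<subseteq> conv d T"
  unfolding conv_def by blast

text \<open>
  A convex combination of convex combinations of the vertices is again one. With
  \<open>conv_mono\<close> this computes convex hulls of sets that contain the vertices.
\<close>

lemma conv_simplex_subset:
  assumes "S \<subseteq> simplex d vs"
  shows "conv d S \<subseteq> simplex d vs"
proof
  fix x assume "x \<in> conv d S"
  then obtain F c where F: "finite F" "F \<subseteq> S" and c: "\<forall>p\<in>F. 0 \<le> c p" "sum c F = (1::real)"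
    and x: "x = vec d (\<lambda>j. \<Sum>p\<in>F. c p * p $ j)"
    unfolding conv_def by auto
  have "\<forall>p\<in>F. \<exists>b. (\<forall>i\<le>d. 0 \<le> b i) \<and> (\<Sum>i\<le>d. b i) = 1 \<and> p = comb d vs b"
    using F assms unfolding simplex_eq_combinations by blast
  then obtain b where b: "\<And>p. p \<in> F \<Longrightarrow> (\<forall>i\<le>d. 0 \<le> b p i) \<and> (\<Sum>i\<le>d. b p i) = 1 \<and> p = comb d vs (b p)"
    by metis
  define c' where "c' i = (\<Sum>p\<in>F. c p * b p i)" for i
  have red: "(\<Sum>i\<le>d. c' i * h i) = (\<Sum>p\<in>F. c p * (\<Sum>i\<le>d. b p i * h i))" for h :: "nat \<Rightarrow> real"
    unfolding c'_def sum_distrib_right sum_distrib_left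
    by (subst sum.swap) (simp add: mult.assoc)
  have "x = comb d vs c'"
  proof (rule eq_vecI)
    fix j assume "j < dim_vec (comb d vs c')"
    then have j: "j < d" by simp
    have "p $ j = (\<Sum>i\<le>d. b p i * vs i $ j)" if "p \<in> F" for p
      using b[OF that] comb_index[OF j] by metis
    then show "x $ j = comb d vs c' $ j" using j by (simp add: x red)
  qed (simp add: x)
  moreover have "(\<Sum>i\<le>d. c' i) = 1" using red[of "\<lambda>_. 1"] c b by simp
  moreover have "\<forall>i\<le>d. 0 \<le> c' i" using c b by (auto simp: c'_def intro!: sum_nonneg mult_nonneg_nonneg)
  ultimately show "x \<in> simplex d vs" unfolding simplex_eq_combinations by blast
qed

lemma vertex_in_simplex:
  assumes "i \<le> d" "vs i \<in> carrier_vec d"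
  shows "vs i \<in> simplex d vs"
  unfolding simplex_eq_combinations
proof (intro CollectI exI conjI)
  show "vs i = comb d vs (\<lambda>j. if j = i then 1 else 0)"
    using assms by (intro eq_vecI) (auto simp: if_distrib[of "\<lambda>x. x * _"] cong: if_cong)
qed (use assms in auto)

text \<open>
  The translation part survives because the weights add up to \<open>1\<close>.
\<close>

lemma affine_image_simplex:
  assumes vs: "\<And>i. i \<le> d \<Longrightarrow> vs i \<in> carrier_vec d"
    and A: "A \<in> carrier_mat d d" and w: "w \<in> carrier_vec d"
  shows "(\<lambda>x. A *\<^sub>v x + w) ` simplex d vs = simplex d (\<lambda>i. A *\<^sub>v vs i + w)"
proof -
  have key: "A *\<^sub>v comb d vs c + w = comb d (\<lambda>i. A *\<^sub>v vs i + w) c" if c: "(\<Sum>i\<le>d. c i) = 1" for c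
  proof (rule eq_vecI)
    fix j assume "j < dim_vec (comb d (\<lambda>i. A *\<^sub>v vs i + w) c)"
    then have j: "j < d" by simp
    have "(A *\<^sub>v comb d vs c) $ j = (\<Sum>l<d. A $$ (j,l) * (\<Sum>i\<le>d. c i * vs i $ l))"
      using A j by (auto simp: scalar_prod_def lessThan_atLeast0 intro!: sum.cong)
    also have "\<dots> = (\<Sum>i\<le>d. c i * (\<Sum>l<d. A $$ (j,l) * vs i $ l))"
      unfolding sum_distrib_left by (subst sum.swap) (simp add: mult_ac)
    finally have 1: "(A *\<^sub>v comb d vs c) $ j = (\<Sum>i\<le>d. c i * (\<Sum>l<d. A $$ (j,l) * vs i $ l))" .
    have 2: "(A *\<^sub>v vs i + w) $ j = (\<Sum>l<d. A $$ (j,l) * vs i $ l) + w $ j" if "i \<le> d" for i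
      using A j w vs[OF that] by (auto simp: scalar_prod_def lessThan_atLeast0 intro!: sum.cong)
    have "comb d (\<lambda>i. A *\<^sub>v vs i + w) c $ j
        = (\<Sum>i\<le>d. c i * ((\<Sum>l<d. A $$ (j,l) * vs i $ l) + w $ j))"
      using j by (simp add: 2)
    also have "\<dots> = (\<Sum>i\<le>d. c i * (\<Sum>l<d. A $$ (j,l) * vs i $ l)) + (\<Sum>i\<le>d. c i) * w $ j"
      by (simp add: distrib_left sum.distrib sum_distrib_right)
    finally show "(A *\<^sub>v comb d vs c + w) $ j = comb d (\<lambda>i. A *\<^sub>v vs i + w) c $ j"
      using 1 c w j by simp
  qed (use A w in simp)
  have "(\<lambda>x. A *\<^sub>v x + w) ` simplex d vs
      = (\<lambda>c. A *\<^sub>v comb d vs c + w) ` {c. (\<forall>i\<le>d. 0 \<le> c i) \<and> (\<Sum>i\<le>d. c i) = 1}"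
    unfolding simplex_eq_combinations by blast
  also have "\<dots> = (\<lambda>c. comb d (\<lambda>i. A *\<^sub>v vs i + w) c) ` {c. (\<forall>i\<le>d. 0 \<le> c i) \<and> (\<Sum>i\<le>d. c i) = 1}"
    by (intro image_cong) (auto simp: key)
  also have "\<dots> = simplex d (\<lambda>i. A *\<^sub>v vs i + w)"
    unfolding simplex_eq_combinations by blast
  finally show ?thesis .
qed

lemma pyr_simplex:
  assumes ws: "\<And>i. i \<le> e \<Longrightarrow> ws i \<in> carrier_vec e"
  shows "pyr e (simplex e ws)
    = simplex (Suc e) (\<lambda>i. if i \<le> e then ws i @\<^sub>v 0\<^sub>v 1 else unit_vec (Suc e) e)"
    (is "_ = simplex (Suc e) ?us")
proof
  have "simplex (Suc e) ?us = conv (Suc e) (?us ` {..Suc e})" by (simp add: simplex_def)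
  also have "\<dots> \<subseteq> pyr e (simplex e ws)"
    unfolding pyr_def Suc_eq_plus1[symmetric]
  proof (rule conv_mono, rule subsetI)
    fix y assume "y \<in> ?us ` {..Suc e}"
    then obtain i where i: "i \<le> Suc e" "y = ?us i" by blast
    show "y \<in> (\<lambda>x. x @\<^sub>v 0\<^sub>v 1) ` simplex e ws \<union> {unit_vec (Suc e) e}"
      using i vertex_in_simplex[of i e ws] ws[of i] by (cases "i \<le> e") simp_all
  qed
  finally show "simplex (Suc e) ?us \<subseteq> pyr e (simplex e ws)" .
  have us: "?us i \<in> carrier_vec (Suc e)" if "i \<le> Suc e" for i
    using ws append_carrier_vec[of "ws i" e "0\<^sub>v 1" 1] by simp
  have "x @\<^sub>v 0\<^sub>v 1 \<in> simplex (Suc e) ?us" if x: "x \<in> simplex e ws" for x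
  proof -
    obtain c where c: "\<forall>i\<le>e. 0 \<le> c i" "(\<Sum>i\<le>e. c i) = 1" and x: "x = comb e ws c"
      using x unfolding simplex_eq_combinations by auto
    show ?thesis
      unfolding simplex_eq_combinations
    proof (intro CollectI exI conjI)
      let ?c = "\<lambda>i. if i \<le> e then c i else 0"
      show "x @\<^sub>v 0\<^sub>v 1 = comb (Suc e) ?us ?c"
      proof (rule eq_vecI)
        fix j assume "j < dim_vec (comb (Suc e) ?us ?c)"
        then have j: "j < Suc e" by simp
        have nth: "(ws i @\<^sub>v 0\<^sub>v 1) $ j = (if j < e then ws i $ j else 0)" if "i \<le> e" for i
          using ws[OF that] j by (simp add: append_vec_def Let_def)
        have "comb (Suc e) ?us ?c $ j = (\<Sum>i\<le>e. c i * (ws i @\<^sub>v 0\<^sub>v 1) $ j)"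
          using j by simp
        also have "\<dots> = (\<Sum>i\<le>e. c i * (if j < e then ws i $ j else 0))"
          by (intro sum.cong refl) (simp add: nth del: One_nat_def)
        finally show "(x @\<^sub>v 0\<^sub>v 1) $ j = comb (Suc e) ?us ?c $ j"
          using j by (auto simp: x)
      qed (simp add: x)
    qed (use c in auto)
  qed
  moreover have "unit_vec (Suc e) e \<in> simplex (Suc e) ?us"
    using vertex_in_simplex[of "Suc e" "Suc e" ?us] us by simp
  ultimately show "pyr e (simplex e ws) \<subseteq> simplex (Suc e) ?us"
    unfolding pyr_def Suc_eq_plus1[symmetric] by (intro conv_simplex_subset) blast
qed

lemma scalar_prod_comb:
  assumes "u \<in> carrier_vec d" "\<And>i. i \<le> d \<Longrightarrow> vs i \<in> carrier_vec d"
  shows "u \<bullet> comb d vs c = (\<Sum>i\<le>d. c i * (u \<bullet> vs i))"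
proof -
  have "u \<bullet> comb d vs c = (\<Sum>l<d. u $ l * (\<Sum>i\<le>d. c i * vs i $ l))"
    by (auto simp: scalar_prod_def lessThan_atLeast0 intro!: sum.cong)
  also have "\<dots> = (\<Sum>i\<le>d. c i * (\<Sum>l<d. u $ l * vs i $ l))"
    unfolding sum_distrib_left by (subst sum.swap) (simp add: mult_ac)
  also have "\<dots> = (\<Sum>i\<le>d. c i * (u \<bullet> vs i))"
    using carrier_vecD[OF assms(2)]
    by (intro sum.cong refl) (simp add: scalar_prod_def lessThan_atLeast0)
  finally show ?thesis .
qed

text \<open>
  If an index \<open>i\<close> has weight strictly between \<open>0\<close> and \<open>1\<close>, rescaling the other weights writes the point
  as a proper convex combination of \<open>vs i\<close> and a point \<open>b\<close> of the simplex. For an extreme point this is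
  possible only if \<open>b = vs i\<close>.
\<close>

lemma vertices_simplex_subset:
  assumes vs: "\<And>i. i \<le> d \<Longrightarrow> vs i \<in> carrier_vec d"
  shows "vertices (simplex d vs) \<subseteq> vs ` {..d}"
proof
  fix x assume x: "x \<in> vertices (simplex d vs)"
  then obtain c where c: "\<forall>i\<le>d. 0 \<le> c i" "(\<Sum>i\<le>d. c i) = 1" and xc: "x = comb d vs c"
    unfolding vertices_def simplex_eq_combinations by auto
  have "\<exists>i\<le>d. c i \<noteq> 0" using c by (metis atMost_iff sum.neutral zero_neq_one)
  then obtain i where i: "i \<le> d" "c i > 0" using c by force
  have split: "sum h {..d} = h i + sum h ({..d} - {i})" for h :: "nat \<Rightarrow> real"
    using i by (simp add: sum.remove)
  have ci: "c i \<le> 1"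
    using split[of c] c sum_nonneg[of "{..d} - {i}" c] by auto
  show "x \<in> vs ` {..d}"
  proof (cases "c i = 1")
    case True
    then have "sum c ({..d} - {i}) = 0" using split[of c] c by simp
    then have "\<forall>j\<in>{..d} - {i}. c j = 0"
      by (subst (asm) sum_nonneg_eq_0_iff) (use c in auto)
    then have "x = vs i"
      unfolding xc using i vs[of i] True by (intro eq_vecI) (auto simp: split)
    then show ?thesis using i by auto
  next
    case False
    define u where "u = 1 - c i"
    have u: "0 < u" "u < 1" using False ci i by (auto simp: u_def)
    define b where "b j = (if j = i then 0 else c j / u)" for j
    have "sum b ({..d} - {i}) = sum c ({..d} - {i}) / u"
      by (simp add: b_def sum_divide_distrib)
    also have "\<dots> = 1" using split[of c] c u by (simp add: u_def)
    finally have "comb d vs b \<in> simplex d vs"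
      unfolding simplex_eq_combinations using c u
      by (intro CollectI exI[of _ b] conjI) (auto simp: b_def split[of "\<lambda>j. if j = i then 0 else c j / u"])
    moreover have "vs i \<in> simplex d vs" using vertex_in_simplex i vs by blast
    moreover have xe: "x = (1 - u) \<cdot>\<^sub>v vs i + u \<cdot>\<^sub>v comb d vs b"
    proof (rule eq_vecI)
      fix j assume "j < dim_vec ((1 - u) \<cdot>\<^sub>v vs i + u \<cdot>\<^sub>v comb d vs b)"
      then have j: "j < d" by simp
      have "u * (\<Sum>l\<in>{..d}-{i}. b l * vs l $ j) = (\<Sum>l\<in>{..d}-{i}. c l * vs l $ j)"
        unfolding sum_distrib_left by (intro sum.cong refl) (use u in \<open>auto simp: b_def\<close>)
      then show "x $ j = ((1 - u) \<cdot>\<^sub>v vs i + u \<cdot>\<^sub>v comb d vs b) $ j"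
        using j vs[OF i(1)] by (simp add: xc split, simp add: u_def b_def)
    qed (simp add: xc)
    ultimately have "vs i = comb d vs b"
      using x u unfolding vertices_def by blast
    then have "x = vs i" using xe vs[OF i(1)] by (intro eq_vecI) (auto simp: algebra_simps)
    then show ?thesis using i by auto
  qed
qed

lemma lattice_polytope_simplex:
  assumes "\<And>i. i \<le> d \<Longrightarrow> vs i \<in> lattice_vecs d"
  shows "lattice_polytope d (simplex d vs)"
proof -
  have "\<And>i. i \<le> d \<Longrightarrow> vs i \<in> carrier_vec d" using assms by (simp add: lattice_vecs_def)
  then show ?thesis
    using vertices_simplex_subset[of d vs] assms
    unfolding lattice_polytope_def is_polytope_def simplex_def by blast
qed

section \<open>The Ehrhart series of a lattice simplex\<close>

text \<open>
  The condition on real representatives \<open>l\<close> that defines membership in \<open>\<Lambda>\<close>.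
\<close>

definition lattice_coeffs :: "nat \<Rightarrow> (nat \<Rightarrow> real vec) \<Rightarrow> (nat \<Rightarrow> real) \<Rightarrow> bool" where
  "lattice_coeffs d vs l \<longleftrightarrow> (\<Sum>i\<le>d. l i) \<in> \<int> \<and> (\<forall>j<d. (\<Sum>i\<le>d. l i * vs i $ j) \<in> \<int>)"

text \<open>
  Elements of \<open>\<Lambda>\<close>, each given by its representatives in \<open>[0,1)\<close>; the functions are extensional, so that an
  element of \<open>\<Lambda>\<close> corresponds to exactly one of them.
\<close>

definition box :: "nat \<Rightarrow> (nat \<Rightarrow> real vec) \<Rightarrow> (nat \<Rightarrow> real) set" where
  "box d vs = {l \<in> {..d} \<rightarrow>\<^sub>E {0..<1}. lattice_coeffs d vs l}"

definition height :: "nat \<Rightarrow> (nat \<Rightarrow> real) \<Rightarrow> nat" where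
  "height d l = nat \<lfloor>\<Sum>i\<le>d. l i\<rfloor>"

text \<open>
  Coefficients with respect to the \<open>(vs i, 1)\<close> of the lattice points \<open>(x, n)\<close> in the cone over the
  simplex.
\<close>

definition cone_slice :: "nat \<Rightarrow> (nat \<Rightarrow> real vec) \<Rightarrow> nat \<Rightarrow> (nat \<Rightarrow> real) set" where
  "cone_slice d vs n = {c \<in> {..d} \<rightarrow>\<^sub>E {0..}. lattice_coeffs d vs c \<and> (\<Sum>i\<le>d. c i) = real n}"

lemma lattice_coeffs_add:
  "lattice_coeffs d vs l \<Longrightarrow> lattice_coeffs d vs l' \<Longrightarrow> lattice_coeffs d vs (\<lambda>i. l i + l' i)"
  by (simp add: lattice_coeffs_def distrib_right sum.distrib)

lemma lattice_coeffs_uminus: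
  "lattice_coeffs d vs l \<Longrightarrow> lattice_coeffs d vs (\<lambda>i. - l i)"
  by (simp add: lattice_coeffs_def sum_negf)

lemma lattice_coeffs_of_Ints:
  assumes "lattice_simplex d vs" and "\<And>i. i \<le> d \<Longrightarrow> l i \<in> \<int>"
  shows "lattice_coeffs d vs l"
  using assms unfolding lattice_coeffs_def lattice_simplex_def lattice_vecs_def
  by (auto intro!: Ints_sum Ints_mult)

text \<open>
  The condition depends only on the classes modulo \<open>\<int>\<close>, as the vertices are lattice points.
\<close>

lemma lattice_coeffs_mod_Ints:
  assumes S: "lattice_simplex d vs" and l: "lattice_coeffs d vs l"
    and diff: "\<And>i. i \<le> d \<Longrightarrow> l' i - l i \<in> \<int>"
  shows "lattice_coeffs d vs l'"
  using lattice_coeffs_add[OF l lattice_coeffs_of_Ints[OF S, of "\<lambda>i. l' i - l i"]] diff by simp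

lemma frac_in_box:
  assumes "lattice_simplex d vs" "lattice_coeffs d vs l"
  shows "(\<lambda>i\<in>{..d}. frac (l i)) \<in> box d vs"
proof -
  have "lattice_coeffs d vs (\<lambda>i\<in>{..d}. frac (l i))"
    by (rule lattice_coeffs_mod_Ints[OF assms]) (simp add: frac_def)
  then show ?thesis by (simp add: box_def frac_lt_1)
qed

lemma box_bounds: "l \<in> box d vs \<Longrightarrow> i \<le> d \<Longrightarrow> 0 \<le> l i \<and> l i < 1"
  unfolding box_def by (auto simp: PiE_iff)

lemma box_eqI:
  assumes "l \<in> box d vs" "l' \<in> box d vs" "\<And>i. i \<le> d \<Longrightarrow> l i = l' i"
  shows "l = l'"
  using assms unfolding box_def by (intro PiE_ext[of l "{..d}" "\<lambda>_. {0..<1}" l']) simp_all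

lemma sum_box_eq_height: "l \<in> box d vs \<Longrightarrow> (\<Sum>i\<le>d. l i) = real (height d l)"
proof -
  assume l: "l \<in> box d vs"
  then obtain z where z: "(\<Sum>i\<le>d. l i) = of_int z"
    unfolding box_def lattice_coeffs_def by (auto elim: Ints_cases)
  have "(\<Sum>i\<le>d. l i) \<ge> 0" using l by (auto simp: box_def PiE_def intro!: sum_nonneg)
  then show ?thesis using z by (simp add: height_def)
qed

lemma affine_coordinates_unique:
  assumes "lattice_simplex d vs" "(\<Sum>i\<le>d. c i) = (\<Sum>i\<le>d. c' i)"
    "\<And>j. j < d \<Longrightarrow> (\<Sum>i\<le>d. c i * vs i $ j) = (\<Sum>i\<le>d. c' i * vs i $ j)" "i \<le> d"
  shows "c i = c' i"
proof -
  have "vec d (\<lambda>j. \<Sum>i\<le>d. (c i - c' i) * vs i $ j) = 0\<^sub>v d"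
    by (intro eq_vecI) (auto simp: left_diff_distrib sum_subtractf assms)
  moreover have "(\<Sum>i\<le>d. c i - c' i) = 0" using assms(2) by (simp add: sum_subtractf)
  moreover have "\<forall>c. (\<Sum>i\<le>d. c i) = 0 \<and> vec d (\<lambda>j. \<Sum>i\<le>d. c i * vs i $ j) = 0\<^sub>v d
      \<longrightarrow> (\<forall>i\<le>d. c i = (0 :: real))"
    using assms(1) unfolding lattice_simplex_def by simp
  ultimately have "\<forall>i\<le>d. c i - c' i = 0" by blast
  then show ?thesis using assms by simp
qed

lemma lattice_points_dilate_simplex:
  assumes n: "n > 0"
  shows "dilate n (simplex d vs) \<inter> lattice_vecs d = comb d vs ` cone_slice d vs n"
proof (intro equalityI subsetI)
  fix x assume "x \<in> dilate n (simplex d vs) \<inter> lattice_vecs d"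
  then obtain c where c: "\<forall>i\<le>d. 0 \<le> c i" "(\<Sum>i\<le>d. c i) = 1" and x: "x = real n \<cdot>\<^sub>v comb d vs c"
    and xl: "x \<in> lattice_vecs d"
    unfolding dilate_def simplex_eq_combinations by auto
  let ?c = "\<lambda>i\<in>{..d}. real n * c i"
  have xc: "x = comb d vs ?c"
    unfolding x by (intro eq_vecI) (auto simp: sum_distrib_left mult.assoc)
  have sm: "(\<Sum>i\<le>d. ?c i) = real n" using c by (simp add: sum_distrib_left[symmetric])
  have "lattice_coeffs d vs ?c"
    unfolding lattice_coeffs_def sm
    using xl unfolding xc lattice_vecs_def by simp
  then have "?c \<in> cone_slice d vs n"
    using c sm by (auto simp: cone_slice_def)
  then show "x \<in> comb d vs ` cone_slice d vs n" using xc by blast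
next
  fix x assume "x \<in> comb d vs ` cone_slice d vs n"
  then obtain c where c: "c \<in> cone_slice d vs n" and x: "x = comb d vs c" by blast
  have "x \<in> lattice_vecs d"
    using c by (auto simp: x lattice_vecs_def cone_slice_def lattice_coeffs_def)
  moreover have "comb d vs (\<lambda>i. c i / real n) \<in> simplex d vs"
    unfolding simplex_eq_combinations using c n
    by (intro CollectI exI conjI refl) (auto simp: cone_slice_def PiE_iff sum_divide_distrib[symmetric])
  moreover have "x = real n \<cdot>\<^sub>v comb d vs (\<lambda>i. c i / real n)"
    unfolding x using n by (intro eq_vecI) (auto simp: sum_distrib_left)
  ultimately show "x \<in> dilate n (simplex d vs) \<inter> lattice_vecs d"
    unfolding dilate_def by blast
qed

lemma card_lattice_points_dilate_simplex:
  assumes S: "lattice_simplex d vs" and n: "n > 0"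
  shows "card (dilate n (simplex d vs) \<inter> lattice_vecs d) = card (cone_slice d vs n)"
  unfolding lattice_points_dilate_simplex[OF n]
proof (intro card_image inj_onI)
  fix c c' assume c: "c \<in> cone_slice d vs n" "c' \<in> cone_slice d vs n"
    and eq: "comb d vs c = comb d vs c'"
  have "c i = c' i" if "i \<le> d" for i
  proof (rule affine_coordinates_unique[where c=c and c'=c', OF S _ _ that])
    show "(\<Sum>i\<le>d. c i * vs i $ j) = (\<Sum>i\<le>d. c' i * vs i $ j)" if "j < d" for j
      using arg_cong[OF eq, of "\<lambda>x. x $ j"] that by simp
    show "(\<Sum>i\<le>d. c i) = (\<Sum>i\<le>d. c' i)" using c unfolding cone_slice_def by simp
  qed
  moreover have "c \<in> {..d} \<rightarrow>\<^sub>E {0..}" "c' \<in> {..d} \<rightarrow>\<^sub>E {0..}"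
    using c unfolding cone_slice_def by simp_all
  ultimately show "c = c'"
    by (metis PiE_ext atMost_iff)
qed

text \<open>
  A box point is determined by its height and by the lattice point that it represents, and both are
  bounded because the coefficients are.
\<close>

lemma finite_box:
  assumes S: "lattice_simplex d vs"
  shows "finite (box d vs)"
proof -
  let ?M = "\<lambda>j. (\<Sum>i\<le>d. \<lfloor>\<bar>vs i $ j\<bar>\<rfloor> + 1)"
  let ?f = "\<lambda>l. (height d l, \<lambda>j\<in>{..<d}. \<lfloor>\<Sum>i\<le>d. l i * vs i $ j\<rfloor>)"
  have bound: "0 \<le> l i \<and> l i \<le> 1" if "l \<in> box d vs" "i \<le> d" for l i
    using box_bounds[OF that] by simp
  have "?f ` box d vs \<subseteq> {..d+1} \<times> ({..<d} \<rightarrow>\<^sub>E {- (\<Sum>j<d. ?M j) - 1..(\<Sum>j<d. ?M j)})"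
  proof (rule image_subsetI)
    fix l assume l: "l \<in> box d vs"
    have "real (height d l) \<le> (\<Sum>i\<le>d. 1)"
      unfolding sum_box_eq_height[OF l, symmetric] using bound[OF l] by (intro sum_mono) auto
    then have "height d l \<le> d + 1" by simp
    moreover have "\<lfloor>\<Sum>i\<le>d. l i * vs i $ j\<rfloor> \<in> {- (\<Sum>j<d. ?M j) - 1..(\<Sum>j<d. ?M j)}" if j: "j < d" for j
    proof -
      have "\<bar>\<Sum>i\<le>d. l i * vs i $ j\<bar> \<le> (\<Sum>i\<le>d. of_int (\<lfloor>\<bar>vs i $ j\<bar>\<rfloor> + 1))"
      proof (rule order.trans[OF sum_abs sum_mono])
        fix i assume "i \<in> {..d}"
        then have "\<bar>l i * vs i $ j\<bar> \<le> 1 * \<bar>vs i $ j\<bar>"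
          unfolding abs_mult using bound[OF l, of i] by (intro mult_right_mono) auto
        then show "\<bar>l i * vs i $ j\<bar> \<le> of_int (\<lfloor>\<bar>vs i $ j\<bar>\<rfloor> + 1)" by linarith
      qed
      then have 1: "\<bar>\<Sum>i\<le>d. l i * vs i $ j\<bar> \<le> of_int (?M j)"
        by (simp add: of_int_sum)
      have "?M j \<le> (\<Sum>j<d. ?M j)"
        by (rule member_le_sum) (use j in \<open>auto intro!: sum_nonneg\<close>)
      then have "\<bar>\<Sum>i\<le>d. l i * vs i $ j\<bar> \<le> of_int (\<Sum>j<d. ?M j)"
        using 1 by (meson of_int_le_iff order.trans)
      then show ?thesis unfolding atLeastAtMost_iff by linarith
    qed
    ultimately show "?f l \<in> {..d+1} \<times> ({..<d} \<rightarrow>\<^sub>E {- (\<Sum>j<d. ?M j) - 1..(\<Sum>j<d. ?M j)})"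
      by auto
  qed
  then have fin: "finite (?f ` box d vs)"
    by (rule finite_subset) (intro finite_cartesian_product finite_PiE; simp)
  moreover have "inj_on ?f (box d vs)"
  proof (rule inj_onI)
    fix l l' assume l: "l \<in> box d vs" "l' \<in> box d vs" and eq: "?f l = ?f l'"
    have "l i = l' i" if "i \<le> d" for i
    proof (rule affine_coordinates_unique[where c=l and c'=l', OF S _ _ that])
      show "(\<Sum>i\<le>d. l i) = (\<Sum>i\<le>d. l' i)" using eq l by (simp add: sum_box_eq_height)
      fix j assume j: "j < d"
      have int: "of_int \<lfloor>\<Sum>i\<le>d. l i * vs i $ j\<rfloor> = (\<Sum>i\<le>d. l i * vs i $ j)" if "l \<in> box d vs" for l
        using that j unfolding box_def lattice_coeffs_def by (auto elim: Ints_cases)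
      have "(\<lambda>j\<in>{..<d}. \<lfloor>\<Sum>i\<le>d. l i * vs i $ j\<rfloor>) j = (\<lambda>j\<in>{..<d}. \<lfloor>\<Sum>i\<le>d. l' i * vs i $ j\<rfloor>) j"
        using eq by (simp only: prod.inject)
      then have fl: "\<lfloor>\<Sum>i\<le>d. l i * vs i $ j\<rfloor> = \<lfloor>\<Sum>i\<le>d. l' i * vs i $ j\<rfloor>" using j by simp
      show "(\<Sum>i\<le>d. l i * vs i $ j) = (\<Sum>i\<le>d. l' i * vs i $ j)"
        by (rule trans[OF int[OF l(1), symmetric] trans[OF _ int[OF l(2)]]]) (simp only: fl)
    qed
    then show "l = l'" using box_eqI[OF l] by blast
  qed
  ultimately show ?thesis by (rule finite_imageD)
qed

text \<open>
  Every lattice point of the cone is in a unique way a box point plus a nonnegative integral combination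
  of the \<open>(vs i, 1)\<close>: take fractional and integral parts of the coefficients.
\<close>

lemma bij_betw_cone_slice:
  assumes S: "lattice_simplex d vs"
  shows "bij_betw (\<lambda>(l :: nat \<Rightarrow> real, m :: nat \<Rightarrow> nat). \<lambda>i\<in>{..d}. l i + real (m i))
    (SIGMA l:box d vs. {m \<in> {..d} \<rightarrow>\<^sub>E UNIV. height d l + (\<Sum>i\<le>d. m i) = n}) (cone_slice d vs n)"
    (is "bij_betw ?f ?A ?B")
proof (rule bij_betw_byWitness[where f' = "\<lambda>c :: nat \<Rightarrow> real. (\<lambda>i\<in>{..d}. frac (c i), \<lambda>i\<in>{..d}. nat \<lfloor>c i\<rfloor>)"])
  let ?g = "\<lambda>c :: nat \<Rightarrow> real. (\<lambda>i\<in>{..d}. frac (c i), \<lambda>i\<in>{..d}. nat \<lfloor>c i\<rfloor>)"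
  have fr: "frac (l i + real (m i)) = l i" "nat \<lfloor>l i + real (m i)\<rfloor> = m i"
    if "l \<in> box d vs" "i \<le> d" for l :: "nat \<Rightarrow> real" and m :: "nat \<Rightarrow> nat" and i
  proof -
    have "0 \<le> l i \<and> l i < 1" using that by (rule box_bounds)
    then have "\<lfloor>l i\<rfloor> = 0" by linarith
    then show "frac (l i + real (m i)) = l i" "nat \<lfloor>l i + real (m i)\<rfloor> = m i"
      by (simp_all add: frac_def)
  qed
  show "\<forall>a\<in>?A. ?g (?f a) = a"
  proof
    fix a assume "a \<in> ?A"
    then obtain l m where a: "a = (l, m)" and l: "l \<in> box d vs" and m: "m \<in> {..d} \<rightarrow>\<^sub>E UNIV"
      by blast
    have "l \<in> extensional {..d}" "m \<in> extensional {..d}" using l m by (auto simp: box_def PiE_def)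
    then show "?g (?f a) = a"
      unfolding a using fr[OF l] by (auto intro!: extensionalityI[of _ "{..d}"])
  qed
  show "\<forall>c\<in>?B. ?f (?g c) = c"
  proof
    fix c :: "nat \<Rightarrow> real" assume c: "c \<in> ?B"
    then have "c \<in> extensional {..d}" and nn: "\<And>i. i \<le> d \<Longrightarrow> 0 \<le> c i"
      by (auto simp: cone_slice_def PiE_def)
    then show "?f (?g c) = c"
      by (auto intro!: extensionalityI[of _ "{..d}"] simp: frac_def)
  qed
  show "?f ` ?A \<subseteq> ?B"
  proof (rule image_subsetI)
    fix a assume "a \<in> ?A"
    then obtain l m where a: "a = (l, m)" and l: "l \<in> box d vs" and n: "height d l + (\<Sum>i\<le>d. m i) = n"
      by blast
    have "\<And>i. i \<le> d \<Longrightarrow> 0 \<le> l i" using box_bounds[OF l] by simp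
    moreover have "lattice_coeffs d vs (\<lambda>i\<in>{..d}. l i + real (m i))"
      by (rule lattice_coeffs_mod_Ints[OF S, of l]) (use l in \<open>auto simp: box_def\<close>)
    moreover have "(\<Sum>i\<le>d. (\<lambda>i\<in>{..d}. l i + real (m i)) i) = real (height d l + (\<Sum>i\<le>d. m i))"
      using sum_box_eq_height[OF l] by (simp add: sum.distrib)
    ultimately show "?f a \<in> cone_slice d vs n"
      unfolding a n[symmetric] by (auto simp: cone_slice_def)
  qed
  show "?g ` ?B \<subseteq> ?A"
  proof (rule image_subsetI)
    fix c :: "nat \<Rightarrow> real" assume c: "c \<in> ?B"
    then have nn: "\<And>i. i \<le> d \<Longrightarrow> 0 \<le> c i"
      by (auto simp: cone_slice_def PiE_def)
    have b: "(\<lambda>i\<in>{..d}. frac (c i)) \<in> box d vs"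
      using c by (intro frac_in_box[OF S]) (simp add: cone_slice_def)
    have "real (height d (\<lambda>i\<in>{..d}. frac (c i)) + (\<Sum>i\<le>d. nat \<lfloor>c i\<rfloor>)) = (\<Sum>i\<le>d. frac (c i) + real (nat \<lfloor>c i\<rfloor>))"
      using sum_box_eq_height[OF b] by (simp add: sum.distrib)
    also have "\<dots> = (\<Sum>i\<le>d. c i)"
      using nn by (intro sum.cong) (auto simp: frac_def)
    also have "\<dots> = real n" using c by (simp add: cone_slice_def)
    finally have "height d (\<lambda>i\<in>{..d}. frac (c i)) + (\<Sum>i\<le>d. nat \<lfloor>c i\<rfloor>) = n" by (simp only: of_nat_eq_iff)
    then show "?g c \<in> ?A" using b by simp
  qed
qed

lemma bij_betw_PiE_lists:
  "bij_betw (\<lambda>m. map m [0..<Suc d]) {m \<in> {..d} \<rightarrow>\<^sub>E UNIV. (\<Sum>i\<le>d. m i) = N}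
    {xs :: nat list. length xs = Suc d \<and> sum_list xs = N}"
proof (rule bij_betw_byWitness[where f' = "\<lambda>xs. \<lambda>i\<in>{..d}. xs ! i"])
  have sl: "sum_list (map m [0..<Suc d]) = (\<Sum>i\<le>d. m i)" for m :: "nat \<Rightarrow> nat"
    unfolding interv_sum_list_conv_sum_set_nat by (simp only: set_upt atLeast0LessThan lessThan_Suc_atMost)
  have mp: "map (\<lambda>i\<in>{..d}. xs ! i) [0..<Suc d] = xs" if "length xs = Suc d" for xs :: "nat list"
    using that by (intro nth_equalityI) (auto simp del: upt_Suc)
  show "\<forall>a\<in>{m \<in> {..d} \<rightarrow>\<^sub>E UNIV. (\<Sum>i\<le>d. m i) = N}. (\<lambda>i\<in>{..d}. map a [0..<Suc d] ! i) = a"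
    by (auto intro!: extensionalityI[of _ "{..d}"] simp: PiE_def simp del: upt_Suc)
  show "\<forall>xs\<in>{xs. length xs = Suc d \<and> sum_list xs = N}. map (\<lambda>i\<in>{..d}. xs ! i) [0..<Suc d] = xs"
    using mp by blast
  show "(\<lambda>m. map m [0..<Suc d]) ` {m \<in> {..d} \<rightarrow>\<^sub>E UNIV. (\<Sum>i\<le>d. m i) = N}
    \<subseteq> {xs. length xs = Suc d \<and> sum_list xs = N}"
    using sl by (auto simp del: upt_Suc)
  show "(\<lambda>xs. \<lambda>i\<in>{..d}. xs ! i) ` {xs :: nat list. length xs = Suc d \<and> sum_list xs = N}
    \<subseteq> {m \<in> {..d} \<rightarrow>\<^sub>E UNIV. (\<Sum>i\<le>d. m i) = N}"
  proof (rule image_subsetI)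
    fix xs :: "nat list" assume xs: "xs \<in> {xs. length xs = Suc d \<and> sum_list xs = N}"
    have "(\<Sum>i\<le>d. (\<lambda>i\<in>{..d}. xs ! i) i) = N"
      unfolding sl[symmetric] using mp[of xs] xs by (simp only: mem_Collect_eq)
    then show "(\<lambda>i\<in>{..d}. xs ! i) \<in> {m \<in> {..d} \<rightarrow>\<^sub>E UNIV. (\<Sum>i\<le>d. m i) = N}"
      by auto
  qed
qed

lemma card_compositions:
  "finite {m \<in> {..d} \<rightarrow>\<^sub>E UNIV. (\<Sum>i\<le>d. m i :: nat) = N}"
  "card {m \<in> {..d} \<rightarrow>\<^sub>E UNIV. (\<Sum>i\<le>d. m i :: nat) = N} = (N + d) choose N"
proof -
  have "{m \<in> {..d} \<rightarrow>\<^sub>E UNIV. (\<Sum>i\<le>d. m i) = N} \<subseteq> {..d} \<rightarrow>\<^sub>E {..N}"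
    using member_le_sum[of _ "{..d}"] by fastforce
  then show "finite {m \<in> {..d} \<rightarrow>\<^sub>E UNIV. (\<Sum>i\<le>d. m i :: nat) = N}"
    by (rule finite_subset) (intro finite_PiE; simp)
  show "card {m \<in> {..d} \<rightarrow>\<^sub>E UNIV. (\<Sum>i\<le>d. m i :: nat) = N} = (N + d) choose N"
    using bij_betw_same_card[OF bij_betw_PiE_lists] card_length_sum_list[of "Suc d" N] by simp
qed

text \<open>
  The power series of \<open>1/(1 - t)\<^sup>m\<close> has the numbers of compositions of \<open>N\<close> into \<open>m\<close> nonnegative parts
  as coefficients. For \<open>m = 0\<close> the truncated subtraction gives the coefficients of \<open>1\<close>, as it should.
\<close>

lemma one_minus_X_power_mult_compositions:
  "(1 - fps_X) ^ m * Abs_fps (\<lambda>N. int ((N + m - 1) choose N)) = 1"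
proof (induction m)
  case 0
  show ?case by (intro fps_ext) (auto simp: binomial_eq_0)
next
  case (Suc m)
  have step: "(1 - fps_X) * Abs_fps (\<lambda>N. int ((N + Suc m - 1) choose N)) = Abs_fps (\<lambda>N. int ((N + m - 1) choose N))"
  proof (rule fps_ext)
    fix n
    show "fps_nth ((1 - fps_X) * Abs_fps (\<lambda>N. int ((N + Suc m - 1) choose N))) n
        = fps_nth (Abs_fps (\<lambda>N. int ((N + m - 1) choose N))) n"
      by (cases n) (simp_all add: left_diff_distrib fps_X_mult_nth)
  qed
  show ?case using Suc unfolding power_Suc2 mult.assoc step .
qed

text \<open>
  A box point \<open>l\<close> of height \<open>h\<close> contributes the compositions of \<open>n - h\<close> into \<open>d + 1\<close> parts to the
  \<open>n\<close>-th coefficient, hence the summand \<open>t\<^sup>h/(1 - t)\<^sup>(\<^sup>d\<^sup>+\<^sup>1\<^sup>)\<close> to the series.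
\<close>

theorem ehrhart_series_simplex:
  assumes S: "lattice_simplex d vs"
  shows "(1 - fps_X) ^ (d + 1) * ehrhart_series d (simplex d vs) = (\<Sum>l\<in>box d vs. fps_X ^ height d l)"
proof -
  let ?G = "Abs_fps (\<lambda>N. int ((N + d) choose N))"
  have card_slice: "int (card (cone_slice d vs n)) = (\<Sum>l\<in>box d vs. fps_nth (fps_X ^ height d l * ?G) n)" for n
  proof -
    let ?T = "\<lambda>l. {m \<in> {..d} \<rightarrow>\<^sub>E UNIV. height d l + (\<Sum>i\<le>d. m i :: nat) = n}"
    have T: "?T l = (if height d l \<le> n then {m \<in> {..d} \<rightarrow>\<^sub>E UNIV. (\<Sum>i\<le>d. m i) = n - height d l} else {})" for l
      by auto
    have cT: "finite (?T l)" "int (card (?T l)) = fps_nth (fps_X ^ height d l * ?G) n" for l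
      unfolding T by (auto simp: fps_X_power_mult_nth card_compositions)
    have "card (cone_slice d vs n) = card (Sigma (box d vs) ?T)"
      using bij_betw_same_card[OF bij_betw_cone_slice[OF S]] by metis
    also have "\<dots> = (\<Sum>l\<in>box d vs. card (?T l))"
      using finite_box[OF S] cT(1) by (intro card_SigmaI) auto
    finally show ?thesis by (simp only: of_nat_sum cT(2))
  qed
  have "cone_slice d vs 0 = {\<lambda>i\<in>{..d}. 0}"
  proof (intro equalityI subsetI)
    fix c assume c: "c \<in> cone_slice d vs 0"
    then have "\<forall>i\<in>{..d}. c i = 0"
      by (subst sum_nonneg_eq_0_iff[symmetric]) (auto simp: cone_slice_def)
    then show "c \<in> {\<lambda>i\<in>{..d}. 0}"
      using c by (auto simp: cone_slice_def PiE_def intro!: extensionalityI[of _ "{..d}"])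
  qed (simp add: cone_slice_def lattice_coeffs_def)
  then have "fps_nth (ehrhart_series d (simplex d vs)) n = int (card (cone_slice d vs n))" for n
    by (simp add: ehrhart_series_def card_lattice_points_dilate_simplex[OF S])
  then have "ehrhart_series d (simplex d vs) = (\<Sum>l\<in>box d vs. fps_X ^ height d l) * ?G"
    by (intro fps_ext) (simp add: card_slice sum_distrib_right fps_sum_nth)
  then show ?thesis
    using one_minus_X_power_mult_compositions[of "d + 1"] by (simp add: mult_ac)
qed

lemma has_delta_polynomial_simplex_iff:
  assumes S: "lattice_simplex d vs"
  shows "has_delta_polynomial d (simplex d vs) \<delta> \<longleftrightarrow> (\<Sum>l\<in>box d vs. monom 1 (height d l)) = \<delta>"
proof -
  have "fps_of_poly (\<Sum>l\<in>box d vs. monom 1 (height d l)) = (\<Sum>l\<in>box d vs. fps_X ^ height d l :: int fps)"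
    by (simp add: fps_of_poly_sum fps_of_poly_monom)
  then show ?thesis
    unfolding has_delta_polynomial_def ehrhart_series_simplex[OF S] by (metis fps_of_poly_eq_iff)
qed

section \<open>A coordinate that vanishes on the group makes the simplex a lattice pyramid\<close>

lemma mult_mat_vec_index:
  assumes "A \<in> carrier_mat n m" "x \<in> carrier_vec m" "r < n"
  shows "(A *\<^sub>v x) $ r = (\<Sum>s<m. A $$ (r, s) * x $ s)"
  using assms by (auto simp: scalar_prod_def lessThan_atLeast0 intro!: sum.cong)

lemma times_mat_index:
  assumes "A \<in> carrier_mat n m" "B \<in> carrier_mat m l" "r < n" "c < l"
  shows "(A * B) $$ (r, c) = (\<Sum>s<m. A $$ (r, s) * B $$ (s, c))"
  using assms by (auto simp: scalar_prod_def lessThan_atLeast0 intro!: sum.cong)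

lemma det_unit_inverse:
  fixes A :: "int mat"
  assumes A: "A \<in> carrier_mat n n" and det: "det A \<in> {1, - 1}"
  obtains B where "B \<in> carrier_mat n n" "A * B = 1\<^sub>m n" "B * A = 1\<^sub>m n"
proof
  let ?B = "det A \<cdot>\<^sub>m adj_mat A"
  have sq: "det A * det A = 1" using det by auto
  show "?B \<in> carrier_mat n n" using adj_mat(1)[OF A] by simp
  show "A * ?B = 1\<^sub>m n" "?B * A = 1\<^sub>m n"
    using adj_mat[OF A] A sq by (auto simp: mult_smult_distrib[of _ n n _ n] mult_smult_assoc_mat[of _ n n _ n] intro!: eq_matI)
qed

text \<open>
  A primitive integral vector can be moved to the last unit vector by a unimodular matrix. This is the
  Euclidean algorithm: while two entries are nonzero, adding or subtracting the smaller one (in absolute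
  value) to the larger one decreases the sum of the absolute values. A single remaining entry is a unit by
  primitivity; it is moved to the last place and made \<open>1\<close>.
\<close>

lemma primitive_vector_to_unit_vec:
  fixes a :: "int vec"
  assumes "a \<in> carrier_vec n" and "n > 0"
    and "\<And>p. (\<forall>i<n. p dvd a $ i) \<Longrightarrow> p dvd 1"
  shows "\<exists>E\<in>carrier_mat n n. det E \<in> {1, - 1} \<and> E *\<^sub>v a = unit_vec n (n - 1)"
  using assms
proof (induction "\<Sum>i<n. nat \<bar>a $ i\<bar>" arbitrary: a rule: less_induct)
  case less
  note a = less.prems(1) and n = less.prems(2) and prim = less.prems(3)
  show ?case
  proof (cases "\<exists>i<n. \<exists>j<n. i \<noteq> j \<and> a $ j \<noteq> 0 \<and> \<bar>a $ j\<bar> \<le> \<bar>a $ i\<bar>")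
    case True
    then obtain i j where ij: "i < n" "j < n" "i \<noteq> j" "a $ j \<noteq> 0" "\<bar>a $ j\<bar> \<le> \<bar>a $ i\<bar>" by blast
    \<comment> \<open>With this sign, adding \<open>s\<close> times the \<open>j\<close>-th entry moves the \<open>i\<close>-th entry towards \<open>0\<close>.\<close>
    define s where "s = - sgn (a $ i) * sgn (a $ j)"
    define M where "M = addrow_mat n s i j"
    define a' where "a' = M *\<^sub>v a"
    have M: "M \<in> carrier_mat n n" by (simp add: M_def)
    have a': "a' \<in> carrier_vec n" using M a by (simp add: a'_def)
    have a'_nth: "a' $ r = a $ r + (if r = i then s * a $ j else 0)" if r: "r < n" for r
    proof -
      have "a' $ r = (\<Sum>l<n. (if l = r then a $ l else 0) + (if l = j then (if r = i then s * a $ j else 0) else 0))"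
        unfolding a'_def mult_mat_vec_index[OF M a r]
        by (intro sum.cong refl) (use r in \<open>auto simp: M_def distrib_right\<close>)
      also have "\<dots> = a $ r + (if r = i then s * a $ j else 0)"
        using r ij by (simp add: sum.distrib)
      finally show ?thesis .
    qed
    have dec: "\<bar>a $ i + s * a $ j\<bar> < \<bar>a $ i\<bar>"
      using ij unfolding s_def by (auto simp: sgn_if split: if_splits)
    have "(\<Sum>r<n. nat \<bar>a' $ r\<bar>) < (\<Sum>r<n. nat \<bar>a $ r\<bar>)"
    proof (rule sum_strict_mono_ex1)
      show "\<forall>r\<in>{..<n}. nat \<bar>a' $ r\<bar> \<le> nat \<bar>a $ r\<bar>" using dec by (auto simp: a'_nth intro!: nat_mono)
      show "\<exists>r\<in>{..<n}. nat \<bar>a' $ r\<bar> < nat \<bar>a $ r\<bar>"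
        using dec ij(1) by (intro bexI[of _ i]) (simp_all add: a'_nth)
    qed simp
    moreover have "p dvd 1" if p: "\<forall>r<n. p dvd a' $ r" for p
    proof (rule prim, intro allI impI)
      have pj: "p dvd a $ j" using p ij a'_nth[of j] by (metis add.right_neutral)
      have "p dvd a' $ i" using p ij(1) by blast
      then have "p dvd a $ i + s * a $ j" using a'_nth[OF ij(1)] by simp
      then have "p dvd a $ i" using pj by (metis dvd_add_left_iff dvd_mult)
      then show "p dvd a $ r" if "r < n" for r
        using p that a'_nth[of r] by (cases "r = i") auto
    qed
    ultimately obtain E where E: "E \<in> carrier_mat n n" "det E \<in> {1, - 1}" "E *\<^sub>v a' = unit_vec n (n - 1)"
      using less.hyps[OF _ a' n] by blast
    show ?thesis
    proof (intro bexI conjI)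
      show "det (E * M) \<in> {1, - 1}"
        using E det_mult[OF E(1) M] det_addrow_mat[OF ij(3), of n s] by (simp add: M_def)
      show "E * M *\<^sub>v a = unit_vec n (n - 1)"
        using E M a by (simp add: a'_def)
    qed (use E M in simp)
  next
    case False
    obtain p where p: "p < n" "a $ p \<noteq> 0"
    proof -
      have "\<exists>p<n. a $ p \<noteq> 0"
        using prim[of 0] by auto
      then show thesis using that by blast
    qed
    have zero: "a $ r = 0" if "r < n" "r \<noteq> p" for r
      using False p that by (metis abs_le_zero_iff linorder_linear abs_zero)
    define c where "c = a $ p"
    have "c dvd 1" using zero unfolding c_def by (intro prim) (metis dvd_0_right dvd_refl)
    then have c: "c = 1 \<or> c = - 1" by auto
    have mult_single: "(E *\<^sub>v b) $ r = b $ q * E $$ (r, q)"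
      if E: "E \<in> carrier_mat n n" and b: "b \<in> carrier_vec n" and r: "r < n" and q: "q < n"
        and b0: "\<And>s. s < n \<Longrightarrow> s \<noteq> q \<Longrightarrow> b $ s = 0" for E :: "int mat" and b r q
    proof -
      have "(E *\<^sub>v b) $ r = (\<Sum>s<n. if s = q then b $ q * E $$ (r, q) else 0)"
        unfolding mult_mat_vec_index[OF E b r] by (intro sum.cong refl) (auto simp: b0)
      then show ?thesis using q by simp
    qed
    define W :: "int mat" where "W = (if p = n - 1 then 1\<^sub>m n else swaprows_mat n p (n - 1))"
    define D :: "int mat" where "D = multrow_mat n (n - 1) c"
    have W: "W \<in> carrier_mat n n" and D: "D \<in> carrier_mat n n" by (simp_all add: W_def D_def)
    have Wa: "W *\<^sub>v a \<in> carrier_vec n" using W a by simp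
    have Wa_nth: "(W *\<^sub>v a) $ r = (if r = n - 1 then c else 0)" if r: "r < n" for r
    proof -
      have "(W *\<^sub>v a) $ r = c * W $$ (r, p)"
        unfolding c_def by (rule mult_single[OF W a r p(1)]) (rule zero)
      then show ?thesis using r p n by (auto simp: W_def)
    qed
    have "det W \<in> {1, - 1}"
      using p n det_swaprows_mat[of p n "n - 1"] by (auto simp: W_def)
    moreover have "det D \<in> {1, - 1}" using c det_multrow_mat[of "n - 1" n c] n by (auto simp: D_def)
    ultimately have "det (D * W) \<in> {1, - 1}" using det_mult[OF D W] by auto
    moreover have "D * W *\<^sub>v a = unit_vec n (n - 1)"
    proof (rule eq_vecI)
      fix r assume "r < dim_vec (unit_vec n (n - 1) :: int vec)"
      then have r: "r < n" by simp
      have "(D * W *\<^sub>v a) $ r = (D *\<^sub>v (W *\<^sub>v a)) $ r" using D W a by simp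
      also have "\<dots> = c * D $$ (r, n - 1)"
        using mult_single[OF D Wa r, of "n - 1"] n by (simp add: Wa_nth)
      also have "\<dots> = unit_vec n (n - 1) $ r" using c n r by (auto simp: D_def)
      finally show "(D * W *\<^sub>v a) $ r = unit_vec n (n - 1) $ r" .
    qed (use D in simp)
    ultimately show ?thesis using D W by (intro bexI[of _ "D * W"]) simp_all
  qed
qed

text \<open>
  The barycentric coordinates of a point are affine functions, given by the rows of the inverse \<open>N\<close> of the
  matrix with columns \<open>(vs j, 1)\<close>. The columns of \<open>N\<close> are the coefficients of the unit vectors, so they
  represent elements of \<open>\<Lambda>\<close>; if the \<open>i\<close>-th coordinate vanishes on \<open>\<Lambda>\<close>, the \<open>i\<close>-th row of \<open>N\<close> is integral.
\<close>

lemma barycentric_coordinate_functional: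
  assumes S: "lattice_simplex d vs" and i: "i \<le> d" and van: "\<forall>l\<in>box d vs. l i = 0"
  obtains a :: "nat \<Rightarrow> int" and b :: int
  where "\<And>j. j \<le> d \<Longrightarrow> (\<Sum>r<d. of_int (a r) * vs j $ r) + of_int b = (if j = i then 1 else 0)"
proof -
  define M where "M = mat (Suc d) (Suc d) (\<lambda>(r, c). if r < d then vs c $ r else 1)"
  have M: "M \<in> carrier_mat (Suc d) (Suc d)" by (simp add: M_def)
  have "det M \<noteq> 0"
  proof
    assume "det M = 0"
    then obtain x where x: "x \<in> carrier_vec (Suc d)" "x \<noteq> 0\<^sub>v (Suc d)" "M *\<^sub>v x = 0\<^sub>v (Suc d)"
      using det_0_iff_vec_prod_zero_field[OF M] by blast
    have row: "(\<Sum>c<Suc d. M $$ (r, c) * x $ c) = 0" if "r < Suc d" for r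
      using mult_mat_vec_index[OF M x(1) that] x(3) that by simp
    have "x $ c = 0" if "c \<le> d" for c
    proof (rule affine_coordinates_unique[where c = "\<lambda>c. x $ c" and c' = "\<lambda>_. 0", OF S _ _ that])
      show "(\<Sum>c\<le>d. x $ c) = (\<Sum>i\<le>d. 0)"
        using row[of d] unfolding lessThan_Suc_atMost by (simp add: M_def)
      show "(\<Sum>c\<le>d. x $ c * vs c $ j) = (\<Sum>i\<le>d. 0 * vs i $ j)" if "j < d" for j
        using row[of j] that unfolding lessThan_Suc_atMost by (simp add: M_def mult.commute)
    qed
    then have "x = 0\<^sub>v (Suc d)" using x(1) by (intro eq_vecI) auto
    then show False using x(2) by simp
  qed
  define N where "N = (1 / det M) \<cdot>\<^sub>m adj_mat M"
  have N: "N \<in> carrier_mat (Suc d) (Suc d)" using adj_mat(1)[OF M] by (simp add: N_def)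
  have MN: "M * N = 1\<^sub>m (Suc d)" and NM: "N * M = 1\<^sub>m (Suc d)"
    using adj_mat[OF M] M \<open>det M \<noteq> 0\<close>
    by (auto simp: N_def mult_smult_distrib[of _ "Suc d" "Suc d" _ "Suc d"]
        mult_smult_assoc_mat[of _ "Suc d" "Suc d" _ "Suc d"] intro!: eq_matI)
  have integral: "N $$ (i, r) \<in> \<int>" if r: "r \<le> d" for r
  proof -
    have MNrow: "(\<Sum>c\<le>d. M $$ (q, c) * N $$ (c, r)) = (if q = r then 1 else 0)" if "q \<le> d" for q
      using times_mat_index[OF M N, of q r] MN r that unfolding lessThan_Suc_atMost by simp
    have "lattice_coeffs d vs (\<lambda>c. N $$ (c, r))"
      unfolding lattice_coeffs_def
    proof (intro conjI allI impI)
      have "(\<Sum>c\<le>d. N $$ (c, r)) = (if d = r then 1 else 0)"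
        using MNrow[of d] by (simp add: M_def)
      then show "(\<Sum>c\<le>d. N $$ (c, r)) \<in> \<int>" by simp
      fix j assume j: "j < d"
      have "(\<Sum>c\<le>d. N $$ (c, r) * vs c $ j) = (if j = r then 1 else 0)"
        using MNrow[of j] j by (simp add: M_def mult.commute)
      then show "(\<Sum>c\<le>d. N $$ (c, r) * vs c $ j) \<in> \<int>" by simp
    qed
    from bspec[OF van frac_in_box[OF S this]] show ?thesis
      using i by simp
  qed
  have "\<exists>z :: int. N $$ (i, r) = of_int z" if "r \<le> d" for r
    using integral[OF that] by (auto elim: Ints_cases)
  then obtain a :: "nat \<Rightarrow> int" where a: "\<And>r. r \<le> d \<Longrightarrow> N $$ (i, r) = of_int (a r)" by metis
  show thesis
  proof (rule that[of a "a d"])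
    fix j assume j: "j \<le> d"
    have "(\<Sum>r<Suc d. N $$ (i, r) * M $$ (r, j)) = (if j = i then 1 else 0)"
      using times_mat_index[OF N M, of i j] NM i j by auto
    then show "(\<Sum>r<d. of_int (a r) * vs j $ r) + of_int (a d) = (if j = i then 1 else 0)"
      using j by (simp add: a M_def)
  qed
qed

text \<open>
  The integral functional that is \<open>1\<close> at \<open>vs i\<close> and \<open>0\<close> at the other vertices shows that \<open>vs i\<close> has lattice
  distance \<open>1\<close> from the opposite facet. A unimodular matrix \<open>E\<close> that moves the linear part of the functional
  to the last unit vector provides coordinates in which the facet lies in the hyperplane where the last
  coordinate is \<open>0\<close>, and \<open>vs i\<close> in the one where it is \<open>1\<close>; a shear then moves \<open>vs i\<close> to the apex.
\<close>

theorem lattice_pyramid_if_coordinate_vanishes: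
  assumes S: "lattice_simplex d vs" and d: "d > 0" and i: "i \<le> d"
    and van: "\<forall>l\<in>box d vs. l i = 0"
  shows "lattice_pyramid d (simplex d vs)"
proof -
  define e where "e = d - 1"
  have de: "d = Suc e" using d by (simp add: e_def)
  obtain a b where ab: "\<And>j. j \<le> d \<Longrightarrow> (\<Sum>r<d. of_int (a r) * vs j $ r) + of_int b = (if j = i then 1 else 0)"
    using barycentric_coordinate_functional[OF S i van] by blast
  obtain \<pi> where \<pi>: "bij_betw \<pi> {..<d} ({..d} - {i})"
    using ex_bij_betw_nat_finite[of "{..d} - {i}"] i by (auto simp: atLeast0LessThan)
  have \<pi>_le: "\<pi> j \<le> d" "\<pi> j \<noteq> i" if "j < d" for j
    using bij_betwE[OF \<pi>] that by auto
  \<comment> \<open>Any vertex of the facet opposite to \<open>vs i\<close> can serve as the new origin.\<close>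
  define m where "m = \<pi> 0"
  have m: "m \<le> d" "m \<noteq> i" using \<pi>_le d by (auto simp: m_def)
  have vs: "vs j \<in> carrier_vec d" if "j \<le> d" for j
    using S that by (simp add: lattice_simplex_def lattice_vecs_def)
  have "\<exists>z :: int. vs j $ r = of_int z" if "j \<le> d" "r < d" for j r
  proof -
    have "vs j $ r \<in> \<int>" using S that by (simp add: lattice_simplex_def lattice_vecs_def)
    then show ?thesis by (rule Ints_cases) blast
  qed
  then obtain z :: "nat \<Rightarrow> nat \<Rightarrow> int" where z: "\<And>j r. j \<le> d \<Longrightarrow> r < d \<Longrightarrow> vs j $ r = of_int (z j r)"
    by metis
  have az: "(\<Sum>r<d. a r * (z j r - z m r)) = (if j = i then 1 else 0)" if j: "j \<le> d" for j
  proof -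
    have "of_int (\<Sum>r<d. a r * (z j r - z m r))
        = (\<Sum>r<d. of_int (a r) * vs j $ r) - (\<Sum>r<d. of_int (a r) * vs m $ r)"
      using j m by (simp add: z right_diff_distrib sum_subtractf)
    also have "\<dots> = of_int (if j = i then 1 else 0)" using ab[OF j] ab[OF m(1)] m by (cases "j = i") auto
    finally show ?thesis by (simp only: of_int_eq_iff)
  qed
  define av where "av = vec d a"
  have av: "av \<in> carrier_vec d" by (simp add: av_def)
  have "p dvd 1" if "\<forall>r<d. p dvd av $ r" for p
    using az[OF i] that dvd_sum[of "{..<d}" p "\<lambda>r. a r * (z i r - z m r)"] by (simp add: av_def)
  from primitive_vector_to_unit_vec[OF av d this]
  obtain E where E: "E \<in> carrier_mat d d" and detE: "det E \<in> {1, - 1}" and Ea: "E *\<^sub>v av = unit_vec d e"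
    by (auto simp: e_def)
  obtain F where F: "F \<in> carrier_mat d d" and EF: "E * F = 1\<^sub>m d" and FE: "F * E = 1\<^sub>m d"
    using det_unit_inverse[OF E detE] .
  have Fe: "F $$ (r, e) = a r" if r: "r < d" for r
  proof -
    have "F *\<^sub>v unit_vec d e = (F * E) *\<^sub>v av" using F E av by (simp add: Ea[symmetric])
    then have "F *\<^sub>v unit_vec d e = av" using FE av by simp
    then have "(F *\<^sub>v unit_vec d e) $ r = a r" using r by (simp add: av_def)
    moreover have "(F *\<^sub>v unit_vec d e) $ r = (\<Sum>s<d. F $$ (r, s) * unit_vec d e $ s)"
      by (rule mult_mat_vec_index[OF F _ r]) simp
    moreover have "(\<Sum>s<d. F $$ (r, s) * unit_vec d e $ s) = (\<Sum>s<d. if s = e then F $$ (r, e) else 0)"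
      by (intro sum.cong) (auto simp: unit_vec_def)
    ultimately show ?thesis using de by simp
  qed
  \<comment> \<open>The coordinates of \<open>vs j - vs m\<close> with respect to the rows of \<open>E\<close> as a lattice basis.\<close>
  define y where "y j s = (\<Sum>r<d. F $$ (r, s) * (z j r - z m r))" for j s
  have Ey: "(\<Sum>s<d. E $$ (s, r) * y j s) = z j r - z m r" if r: "r < d" for j r
  proof -
    have FEq: "(\<Sum>s<d. F $$ (q, s) * E $$ (s, r)) = (if q = r then 1 else 0)" if "q < d" for q
      using times_mat_index[OF F E that r] FE r that by simp
    have "(\<Sum>s<d. E $$ (s, r) * y j s) = (\<Sum>q<d. (\<Sum>s<d. F $$ (q, s) * E $$ (s, r)) * (z j q - z m q))"
      unfolding y_def sum_distrib_left sum_distrib_right by (subst sum.swap) (simp add: mult_ac)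
    also have "\<dots> = (\<Sum>q<d. if q = r then z j q - z m q else 0)"
      by (intro sum.cong refl) (simp add: FEq)
    finally show ?thesis using r by simp
  qed
  have ye: "y j e = (if j = i then 1 else 0)" if "j \<le> d" for j
    unfolding y_def az[OF that, symmetric] by (intro sum.cong refl) (simp add: Fe)
  \<comment> \<open>The columns are the rows of \<open>E\<close> except the last, then the edge from the new origin to \<open>vs i\<close>.\<close>
  define A where "A = mat d d (\<lambda>(r, c). if c < e then E $$ (c, r) else z i r - z m r)"
  \<comment> \<open>The shear that accounts for this replacement; the corner entry is \<open>y i e = 1\<close>.\<close>
  define T where "T = mat d d (\<lambda>(r, c). if c < e then (if r = c then 1 else 0) else y i r)"
  have A: "A \<in> carrier_mat d d" and T: "T \<in> carrier_mat d d" by (simp_all add: A_def T_def)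
  have "A = transpose_mat E * T"
  proof (rule eq_matI)
    fix r c assume "r < dim_row (transpose_mat E * T)" "c < dim_col (transpose_mat E * T)"
    then have rc: "r < d" "c < d" using E T by auto
    have "(transpose_mat E * T) $$ (r, c) = (\<Sum>s<d. E $$ (s, r) * T $$ (s, c))"
      using times_mat_index[of "transpose_mat E" d d T d r c] E T rc by (auto intro!: sum.cong)
    also have "\<dots> = A $$ (r, c)"
    proof (cases "c < e")
      case True
      then have "(\<Sum>s<d. E $$ (s, r) * T $$ (s, c)) = (\<Sum>s<d. if s = c then E $$ (c, r) else 0)"
        using rc by (intro sum.cong) (auto simp: T_def)
      then show ?thesis using rc True by (simp add: A_def)
    next
      case False
      then have "(\<Sum>s<d. E $$ (s, r) * T $$ (s, c)) = (\<Sum>s<d. E $$ (s, r) * y i s)"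
        using rc by (intro sum.cong) (auto simp: T_def)
      then show ?thesis using rc False Ey by (simp add: A_def)
    qed
    finally show "A $$ (r, c) = (transpose_mat E * T) $$ (r, c)" by simp
  qed (use A E T in auto)
  moreover have "det T = 1"
  proof -
    have "upper_triangular T" by (auto simp: upper_triangular_def T_def de)
    then have "det T = prod_list (diag_mat T)" using T by (rule det_upper_triangular)
    also have "\<dots> = (\<Prod>r = 0..<d. T $$ (r, r))" using T by (simp add: prod_list_diag_prod)
    also have "\<dots> = 1" using ye[OF i] by (intro prod.neutral) (auto simp: T_def de less_Suc_eq)
    finally show ?thesis .
  qed
  ultimately have detA: "det A \<in> {1, - 1}"
    using det_mult[of "transpose_mat E" d T] det_transpose[OF E] detE E T by simp
  define ws where "ws j = vec e (\<lambda>s. of_int (y (\<pi> j) s) :: real)" for j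
  define us where "us j = (if j \<le> e then ws j @\<^sub>v 0\<^sub>v 1 else unit_vec (Suc e) e)" for j
  have ws: "ws j \<in> carrier_vec e" for j by (simp add: ws_def)
  have us_nth: "us j $ s = of_int (y (\<pi> j) s)" if "j \<le> e" "s < d" for j s
  proof -
    have "j < d" using that by (simp add: de)
    then have "y (\<pi> j) e = 0" using ye[of "\<pi> j"] \<pi>_le[of j] by simp
    then show ?thesis
      using that by (auto simp: us_def ws_def de append_vec_def Let_def less_Suc_eq)
  qed
  have us: "us j \<in> carrier_vec d" if "j \<le> d" for j
    using ws append_carrier_vec[of "ws j" e "0\<^sub>v 1" 1] by (simp add: us_def de)
  let ?A = "map_mat real_of_int A"
  have RA: "?A \<in> carrier_mat d d" using A by simp
  have A_us: "?A *\<^sub>v us j + vs m = (if j < d then vs (\<pi> j) else vs i)" if j: "j \<le> d" for j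
  proof (rule eq_vecI)
    fix r assume "r < dim_vec (if j < d then vs (\<pi> j) else vs i)"
    then have r: "r < d" using carrier_vecD[OF vs] \<pi>_le i by (auto split: if_splits)
    have exp: "(?A *\<^sub>v us j) $ r = (\<Sum>s<e. of_int (E $$ (s, r)) * us j $ s) + of_int (z i r - z m r) * us j $ e"
      using mult_mat_vec_index[OF RA us[OF j] r] A r by (simp add: de A_def)
    show "(?A *\<^sub>v us j + vs m) $ r = (if j < d then vs (\<pi> j) else vs i) $ r"
    proof (cases "j < d")
      case True
      then have je: "j \<le> e" by (simp add: de)
      have "us j $ e = 0" using us_nth[OF je, of e] ye \<pi>_le[OF True] by (simp add: de)
      moreover have "(\<Sum>s<e. of_int (E $$ (s, r)) * us j $ s) = of_int (\<Sum>s<e. E $$ (s, r) * y (\<pi> j) s)"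
        using us_nth[OF je] by (simp add: de)
      moreover have "(\<Sum>s<e. E $$ (s, r) * y (\<pi> j) s) = z (\<pi> j) r - z m r"
        using Ey[OF r, of "\<pi> j"] ye[of "\<pi> j"] \<pi>_le[OF True] by (simp add: de)
      ultimately have "(?A *\<^sub>v us j) $ r = of_int (z (\<pi> j) r - z m r)" using exp by simp
      then show ?thesis using True r vs[OF m(1)] RA \<pi>_le[OF True] m by (simp add: z)
    next
      case False
      then have "us j = unit_vec (Suc e) e" using j by (simp add: us_def de)
      then have "(?A *\<^sub>v us j) $ r = of_int (z i r - z m r)" using exp by simp
      then show ?thesis using False r vs[OF m(1)] RA i m by (simp add: z)
    qed
  next
    show "dim_vec (?A *\<^sub>v us j + vs m) = dim_vec (if j < d then vs (\<pi> j) else vs i)"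
      using vs[OF m(1)] carrier_vecD[OF vs] \<pi>_le i by simp
  qed
  have "lattice_simplex e ws"
    unfolding lattice_simplex_def
  proof (intro conjI allI impI)
    show "ws j \<in> lattice_vecs e" for j by (simp add: lattice_vecs_def ws_def)
    fix c :: "nat \<Rightarrow> real" and j
    assume c: "sum c {..e} = 0 \<and> vec e (\<lambda>s. \<Sum>j\<le>e. c j * ws j $ s) = 0\<^sub>v e" and j: "j \<le> e"
    have us0: "(\<Sum>j\<le>e. c j * us j $ s) = 0" if s: "s < d" for s
    proof (cases "s < e")
      case True
      then have "(\<Sum>j\<le>e. c j * us j $ s) = (\<Sum>j\<le>e. c j * ws j $ s)"
        using s by (intro sum.cong refl) (simp add: us_nth ws_def)
      also have "\<dots> = vec e (\<lambda>s. \<Sum>j\<le>e. c j * ws j $ s) $ s" using True by simp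
      also have "\<dots> = 0" using c True by simp
      finally show ?thesis .
    next
      case False
      then have "s = e" using s by (simp add: de)
      then show ?thesis using us_nth[of _ e] ye \<pi>_le by (simp add: de)
    qed
    define c' where "c' t = (if t = i then 0 else c (inv_into {..<d} \<pi> t))" for t
    have reindex: "(\<Sum>t\<le>d. c' t * h t) = (\<Sum>j\<le>e. c j * h (\<pi> j))" for h :: "nat \<Rightarrow> real"
    proof -
      have "(\<Sum>t\<le>d. c' t * h t) = (\<Sum>t\<in>{..d} - {i}. c' t * h t)"
        by (rule sum.mono_neutral_right) (auto simp: c'_def)
      also have "\<dots> = (\<Sum>j<d. c' (\<pi> j) * h (\<pi> j))"
        by (rule sum.reindex_bij_betw[OF \<pi>, symmetric])
      also have "\<dots> = (\<Sum>j<d. c j * h (\<pi> j))"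
        using \<pi>_le \<pi> by (intro sum.cong refl) (simp add: c'_def bij_betw_def)
      finally show ?thesis by (simp add: de lessThan_Suc_atMost)
    qed
    have "c' (\<pi> j) = 0"
    proof (rule affine_coordinates_unique[where c = c' and c' = "\<lambda>_. 0", OF S])
      show "(\<Sum>i\<le>d. c' i) = (\<Sum>i\<le>d. 0)" using reindex[of "\<lambda>_. 1"] c by simp
      fix r assume r: "r < d"
      have vr: "vs (\<pi> j) $ r = (\<Sum>s<d. ?A $$ (r, s) * us j $ s) + vs m $ r" if "j \<le> e" for j
      proof -
        have "vs (\<pi> j) = ?A *\<^sub>v us j + vs m" using A_us[of j] that by (simp add: de)
        then show ?thesis
          using mult_mat_vec_index[OF RA us r, of j] vs[OF m(1)] r that by (simp add: de)
      qed
      have "(\<Sum>t\<le>d. c' t * vs t $ r) = (\<Sum>j\<le>e. c j * ((\<Sum>s<d. ?A $$ (r, s) * us j $ s) + vs m $ r))"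
        unfolding reindex by (intro sum.cong refl) (simp add: vr)
      also have "\<dots> = (\<Sum>s<d. ?A $$ (r, s) * (\<Sum>j\<le>e. c j * us j $ s)) + sum c {..e} * vs m $ r"
        unfolding distrib_left sum.distrib sum_distrib_left sum_distrib_right
        by (subst sum.swap) (simp add: mult_ac)
      also have "\<dots> = 0" using us0 c by simp
      finally show "(\<Sum>t\<le>d. c' t * vs t $ r) = (\<Sum>t\<le>d. 0 * vs t $ r)" by simp
    qed (use \<pi>_le j in \<open>simp add: de\<close>)
    then show "c j = 0" using \<pi>_le[of j] \<pi> j by (simp add: c'_def bij_betw_def de)
  qed
  moreover have "unimodularly_equivalent d (iterated_pyr e (d - e) (simplex e ws)) (simplex d vs)"
    unfolding unimodularly_equivalent_def
  proof (intro exI conjI)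
    show "transpose_mat A \<in> carrier_mat d d" using A by simp
    show "det (transpose_mat A) \<in> {1, - 1}" using detA det_transpose[OF A] by simp
    show "vs m \<in> lattice_vecs d" using S m by (simp add: lattice_simplex_def)
    have "iterated_pyr e (d - e) (simplex e ws) = simplex d us"
      using pyr_simplex[of e ws] ws by (simp add: de us_def[abs_def])
    moreover have "transpose_mat (map_mat real_of_int (transpose_mat A)) = ?A"
      by (intro eq_matI) auto
    moreover have "(\<lambda>x. ?A *\<^sub>v x + vs m) ` simplex d us = simplex d (\<lambda>j. ?A *\<^sub>v us j + vs m)"
      using us RA vs[OF m(1)] by (rule affine_image_simplex)
    moreover have "(\<lambda>j. ?A *\<^sub>v us j + vs m) ` {..d} = vs ` {..d}"
    proof -
      have "(\<lambda>j. ?A *\<^sub>v us j + vs m) ` {..d} = (\<lambda>j. if j < d then vs (\<pi> j) else vs i) ` {..d}"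
        by (intro image_cong) (simp_all add: A_us)
      also have "\<dots> = vs ` insert i (\<pi> ` {..<d})"
      proof -
        have "{..d} = insert d {..<d}" by auto
        then show ?thesis by (simp add: image_image) auto
      qed
      also have "insert i (\<pi> ` {..<d}) = {..d}"
        using \<pi> i by (auto simp: bij_betw_def)
      finally show ?thesis .
    qed
    ultimately show "simplex d vs = (\<lambda>x. transpose_mat (map_mat real_of_int (transpose_mat A)) *\<^sub>v x + vs m)
        ` iterated_pyr e (d - e) (simplex e ws)"
      unfolding simplex_def by simp
  qed
  ultimately show ?thesis
    unfolding lattice_pyramid_def using de by blast
qed

section \<open>Coordinate sums over the group of a lattice simplex\<close>

lemma bij_betw_box_translation:
  assumes S: "lattice_simplex d vs" and l: "l \<in> box d vs"
  shows "bij_betw (\<lambda>m. \<lambda>i\<in>{..d}. frac (l i + m i)) (box d vs) (box d vs)" (is "bij_betw ?t _ _")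
proof -
  have "?t ` box d vs \<subseteq> box d vs"
  proof (rule image_subsetI)
    fix m assume "m \<in> box d vs"
    then show "?t m \<in> box d vs"
      using l by (intro frac_in_box[OF S] lattice_coeffs_add) (auto simp: box_def)
  qed
  moreover have "inj_on ?t (box d vs)"
  proof (rule inj_onI)
    fix m m' assume m: "m \<in> box d vs" "m' \<in> box d vs" and eq: "?t m = ?t m'"
    show "m = m'"
    proof (rule box_eqI[OF m])
      fix i assume i: "i \<le> d"
      have "frac (l i + m i) = frac (l i + m' i)" using fun_cong[OF eq, of i] i by simp
      then have diff: "m i - m' i = of_int (\<lfloor>l i + m i\<rfloor> - \<lfloor>l i + m' i\<rfloor>)"
        by (simp add: frac_def)
      then have "\<bar>m i - m' i\<bar> = of_int \<bar>\<lfloor>l i + m i\<rfloor> - \<lfloor>l i + m' i\<rfloor>\<bar>" by simp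
      moreover have "\<bar>m i - m' i\<bar> < 1"
        using box_bounds[OF m(1) i] box_bounds[OF m(2) i] by linarith
      ultimately have "\<lfloor>l i + m i\<rfloor> - \<lfloor>l i + m' i\<rfloor> = 0" by linarith
      then show "m i = m' i" using diff by simp
    qed
  qed
  ultimately show ?thesis
    using finite_box[OF S] by (simp add: bij_betw_def endo_inj_surj)
qed

lemma bij_betw_box_negation:
  assumes S: "lattice_simplex d vs"
  shows "bij_betw (\<lambda>m. \<lambda>i\<in>{..d}. frac (- m i)) (box d vs) (box d vs)" (is "bij_betw ?t _ _")
proof (rule bij_betw_byWitness[where f' = ?t])
  show sub: "?t ` box d vs \<subseteq> box d vs"
  proof (rule image_subsetI)
    fix m assume "m \<in> box d vs"
    then show "?t m \<in> box d vs"
      by (intro frac_in_box[OF S] lattice_coeffs_uminus) (simp add: box_def)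
  qed
  then show "?t ` box d vs \<subseteq> box d vs" .
  have inv: "?t (?t m) = m" if m: "m \<in> box d vs" for m
  proof (rule box_eqI)
    show "?t (?t m) \<in> box d vs" using sub m by blast
    fix i assume i: "i \<le> d"
    then have "?t (?t m) i = frac (- frac (- m i))" by simp
    also have "\<dots> = frac (m i)" by (simp add: frac_def)
    also have "\<dots> = m i" using box_bounds[OF m i] by (simp add: frac_eq)
    finally show "?t (?t m) i = m i" .
  qed (rule m)
  then show "\<forall>m\<in>box d vs. ?t (?t m) = m" "\<forall>m\<in>box d vs. ?t (?t m) = m" by blast+
qed

text \<open>
  Lagrange's theorem for \<open>\<Lambda>\<close>: translation by \<open>l\<close> permutes the box modulo \<open>\<int>\<close>, so it changes the sum of
  the \<open>i\<close>-th coordinates both by \<open>0\<close> and, modulo \<open>\<int>\<close>, by the order of \<open>\<Lambda>\<close> times \<open>l i\<close>.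
\<close>

lemma card_box_mult_coordinate_Ints:
  assumes S: "lattice_simplex d vs" and l: "l \<in> box d vs" and i: "i \<le> d"
  shows "real (card (box d vs)) * l i \<in> \<int>"
proof -
  have "(\<Sum>m\<in>box d vs. m i) = (\<Sum>m\<in>box d vs. (\<lambda>i\<in>{..d}. frac (l i + m i)) i)"
    by (rule sum.reindex_bij_betw[OF bij_betw_box_translation[OF S l], symmetric])
  also have "\<dots> = (\<Sum>m\<in>box d vs. l i + m i - of_int \<lfloor>l i + m i\<rfloor>)"
    using i by (simp add: frac_def)
  also have "\<dots> = real (card (box d vs)) * l i + (\<Sum>m\<in>box d vs. m i) - (\<Sum>m\<in>box d vs. of_int \<lfloor>l i + m i\<rfloor>)"
    by (simp add: sum.distrib sum_subtractf)
  finally have "real (card (box d vs)) * l i = (\<Sum>m\<in>box d vs. of_int \<lfloor>l i + m i\<rfloor>)" by linarith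
  then show ?thesis by (simp only: of_int_sum[symmetric] Ints_of_int)
qed

text \<open>
  Translation by \<open>l\<close> maps the box points with vanishing \<open>i\<close>-th coordinate injectively to box points
  where it does not vanish, so the latter are at least half of all. A box point with nonzero \<open>i\<close>-th
  coordinate and its negative have \<open>i\<close>-th coordinates that add up to \<open>1\<close>.
\<close>

lemma card_box_le_sum_coordinate:
  assumes S: "lattice_simplex d vs" and i: "i \<le> d" and l: "l \<in> box d vs" "l i \<noteq> 0"
  shows "real (card (box d vs)) \<le> 4 * (\<Sum>m\<in>box d vs. m i)"
proof -
  let ?Z = "{m\<in>box d vs. m i = 0}" and ?N = "{m\<in>box d vs. m i \<noteq> 0}"
  note fin = finite_box[OF S]
  have bnd: "0 \<le> m i" "m i < 1" if "m \<in> box d vs" for m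
    using box_bounds[OF that i] by simp_all
  have "card ?Z \<le> card ?N"
  proof (rule card_inj_on_le)
    let ?t = "\<lambda>m. \<lambda>i\<in>{..d}. frac (l i + m i)"
    have t: "bij_betw ?t (box d vs) (box d vs)" by (rule bij_betw_box_translation[OF S l(1)])
    show "inj_on ?t ?Z" using bij_betw_imp_inj_on[OF t] by (rule inj_on_subset) blast
    show "?t ` ?Z \<subseteq> ?N"
    proof (rule image_subsetI)
      fix m assume m: "m \<in> ?Z"
      then have "?t m i = l i" using i bnd[OF l(1)] by (simp add: frac_eq)
      then show "?t m \<in> ?N" using m l bij_betwE[OF t] by auto
    qed
  qed (use fin in simp)
  moreover have "card (box d vs) = card ?Z + card ?N"
    using fin by (subst card_Un_disjoint[symmetric]) (auto intro: arg_cong[of _ _ card])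
  ultimately have half: "real (card (box d vs)) \<le> 2 * real (card ?N)" by linarith
  have "(\<Sum>m\<in>box d vs. m i) = (\<Sum>m\<in>box d vs. (\<lambda>i\<in>{..d}. frac (- m i)) i)"
    by (rule sum.reindex_bij_betw[OF bij_betw_box_negation[OF S], symmetric])
  then have "2 * (\<Sum>m\<in>box d vs. m i) = (\<Sum>m\<in>box d vs. m i + frac (- m i))"
    using i by (simp add: sum.distrib)
  also have "\<dots> = (\<Sum>m\<in>box d vs. if m i \<noteq> 0 then 1 else 0)"
  proof (rule sum.cong)
    fix m assume m: "m \<in> box d vs"
    show "m i + frac (- m i) = (if m i \<noteq> 0 then 1 else 0)"
      using bnd[OF m] frac_neg[of "m i"] frac_eq[of "m i"] by (auto elim: Ints_cases)
  qed simp
  also have "\<dots> = real (card ?N)" using fin by (simp add: sum.If_cases Int_def)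
  finally show ?thesis using half by simp
qed


section \<open>The diagonal subgroup of the torus\<close>

lemma subgroup_Ints_real_group: "subgroup \<int> real_group" and comm_group_real_group: "comm_group real_group"
proof -
  show cg: "comm_group real_group"
  proof (rule comm_groupI)
    fix x :: real assume "x \<in> carrier real_group"
    show "\<exists>y\<in>carrier real_group. y \<otimes>\<^bsub>real_group\<^esub> x = \<one>\<^bsub>real_group\<^esub>"
      by (rule bexI[of _ "- x"]) (simp_all add: real_group_def)
  qed (simp_all add: real_group_def)
  interpret comm_group real_group by (rule cg)
  have inv: "inv\<^bsub>real_group\<^esub> x = - x" for x
    by (rule inv_equality) (simp_all add: real_group_def)
  show "subgroup \<int> real_group"
    by (rule subgroupI) (auto simp: inv, auto simp: real_group_def)
qed

lemma group_real_mod_int: "group real_mod_int"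
proof -
  interpret comm_group real_group by (rule comm_group_real_group)
  have "\<int> \<lhd> real_group"
    using subgroup_imp_normal[OF subgroup_Ints_real_group] .
  then show ?thesis unfolding real_mod_int_def by (rule normal.factorgroup_is_group)
qed

lemma mod_int_eq_iff: "mod_int x = mod_int y \<longleftrightarrow> x - y \<in> \<int>"
proof -
  have set: "mod_int x = {u. u - x \<in> \<int>}" for x
    unfolding mod_int_def r_coset_def real_group_def
    by (auto intro!: bexI[of _ "_ - x"])
  show ?thesis
  proof
    assume "mod_int x = mod_int y"
    moreover have "x \<in> mod_int x" by (simp add: set)
    ultimately show "x - y \<in> \<int>" by (simp add: set)
  next
    assume xy: "x - y \<in> \<int>"
    have "u - x \<in> \<int> \<longleftrightarrow> u - y \<in> \<int>" for u
      using Ints_add[OF _ xy, of "u - x"] Ints_diff[OF _ xy, of "u - y"] by auto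
    then show "mod_int x = mod_int y" by (simp add: set)
  qed
qed

lemma mult_mod_int: "mod_int x \<otimes>\<^bsub>real_mod_int\<^esub> mod_int y = mod_int (x + y)"
proof -
  interpret comm_group real_group by (rule comm_group_real_group)
  have "\<int> \<lhd> real_group"
    using subgroup_imp_normal[OF subgroup_Ints_real_group] .
  from normal.rcos_sum[OF this, of x y] show ?thesis
    unfolding real_mod_int_def mod_int_def FactGroup_def by (simp add: real_group_def)
qed

lemma one_real_mod_int: "\<one>\<^bsub>real_mod_int\<^esub> = mod_int 0"
  unfolding real_mod_int_def mod_int_def FactGroup_def r_coset_def real_group_def by simp

lemma mod_int_carrier: "mod_int x \<in> carrier real_mod_int"
  unfolding real_mod_int_def mod_int_def FactGroup_def RCOSETS_def by (auto simp: real_group_def)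

text \<open>
  The image of a real number in the diagonal of \<open>(\<real>/\<int>)\<^sup>(\<^sup>d\<^sup>+\<^sup>1\<^sup>)\<close>.
\<close>

definition diagonal_point :: "nat \<Rightarrow> real \<Rightarrow> nat \<Rightarrow> real set" where
  "diagonal_point d x = (\<lambda>i\<in>{..<d + 1}. mod_int x)"

lemma diagonal_point_eq_iff: "diagonal_point d x = diagonal_point d y \<longleftrightarrow> x - y \<in> \<int>"
proof
  assume "diagonal_point d x = diagonal_point d y"
  from fun_cong[OF this, of 0] show "x - y \<in> \<int>" by (simp add: diagonal_point_def mod_int_eq_iff)
next
  assume "x - y \<in> \<int>"
  then have "mod_int x = mod_int y" by (simp only: mod_int_eq_iff)
  then show "diagonal_point d x = diagonal_point d y" by (simp only: diagonal_point_def)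
qed

lemma mult_diagonal_point:
  "diagonal_point d x \<otimes>\<^bsub>torus (d + 1)\<^esub> diagonal_point d y = diagonal_point d (x + y)"
  unfolding diagonal_point_def torus_def by (auto simp: mult_mod_int intro!: restrict_ext)

lemma group_torus: "group (torus n)"
  unfolding torus_def by (rule product_group) (simp add: group_real_mod_int)

lemma one_torus: "\<one>\<^bsub>torus (d + 1)\<^esub> = diagonal_point d 0"
  unfolding diagonal_point_def torus_def by (auto simp: one_real_mod_int)

lemma inv_diagonal_point: "inv\<^bsub>torus (d + 1)\<^esub> diagonal_point d x = diagonal_point d (- x)"
proof (rule group.inv_equality[OF group_torus])
  show "diagonal_point d (- x) \<otimes>\<^bsub>torus (d + 1)\<^esub> diagonal_point d x = \<one>\<^bsub>torus (d + 1)\<^esub>"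
    unfolding mult_diagonal_point one_torus by simp
  show "diagonal_point d x \<in> carrier (torus (d + 1))" "diagonal_point d (- x) \<in> carrier (torus (d + 1))"
    unfolding diagonal_point_def torus_def by (simp_all add: mod_int_carrier)
qed

lemma generate_diagonal_point:
  "generate (torus (d + 1)) {diagonal_point d x} = range (\<lambda>z :: int. diagonal_point d (of_int z * x))"
proof (intro equalityI subsetI)
  fix g assume "g \<in> generate (torus (d + 1)) {diagonal_point d x}"
  then show "g \<in> range (\<lambda>z :: int. diagonal_point d (of_int z * x))"
  proof (induction rule: generate.induct)
    case one
    show ?case by (rule range_eqI[of _ _ 0]) (simp add: one_torus[simplified])
  next
    case (incl h)
    then show ?case by (intro range_eqI[of _ _ 1]) simp
  next
    case (inv h)
    then show ?case
      using inv_diagonal_point[of d x] by (intro range_eqI[of _ _ "- 1"]) simp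
  next
    case (eng h1 h2)
    then obtain z1 z2 :: int where "h1 = diagonal_point d (of_int z1 * x)" "h2 = diagonal_point d (of_int z2 * x)"
      by blast
    then show ?case
      using mult_diagonal_point[of d "of_int z1 * x" "of_int z2 * x"]
      by (intro range_eqI[of _ _ "z1 + z2"]) (simp add: distrib_right)
  qed
next
  let ?G = "generate (torus (d + 1)) {diagonal_point d x}"
  have nat: "diagonal_point d (real n * y) \<in> ?G" if "diagonal_point d y \<in> ?G" for n y
  proof (induction n)
    case 0
    show ?case using generate.one[of "torus (d + 1)" "{diagonal_point d x}"] unfolding one_torus by simp
  next
    case (Suc n)
    then show ?case
      using generate.eng[OF that Suc] unfolding mult_diagonal_point by (simp add: distrib_right)
  qed
  fix g assume "g \<in> range (\<lambda>z :: int. diagonal_point d (of_int z * x))"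
  then obtain z :: int where g: "g = diagonal_point d (of_int z * x)" by blast
  have "diagonal_point d x \<in> ?G" "diagonal_point d (- x) \<in> ?G"
    using generate.incl[of "diagonal_point d x" "{diagonal_point d x}"]
      generate.inv[of "diagonal_point d x" "{diagonal_point d x}" "torus (d + 1)"] unfolding inv_diagonal_point by simp_all
  then show "g \<in> ?G"
    using nat[of x "nat z"] nat[of "- x" "nat (- z)"] by (cases "z \<ge> 0") (simp_all add: g)
qed

lemma Lambda_eq_image_box:
  assumes S: "lattice_simplex d vs"
  shows "Lambda d vs = (\<lambda>l. \<lambda>i\<in>{..<d + 1}. mod_int (l i)) ` box d vs"
proof -
  have vs: "vs i \<in> carrier_vec d" if "i \<le> d" for i
    using S that by (simp add: lattice_simplex_def lattice_vecs_def)
  have nth: "(vs i @\<^sub>v vec 1 (\<lambda>_. 1)) $ j = (if j < d then vs i $ j else 1)" if "i \<le> d" "j < d + 1" for i j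
    using carrier_vecD[OF vs[OF that(1)]] that(2) by (auto simp: append_vec_def Let_def)
  have lat: "vec (d + 1) (\<lambda>j. \<Sum>i\<le>d. l i * (vs i @\<^sub>v vec 1 (\<lambda>_. 1)) $ j) \<in> lattice_vecs (d + 1)
      \<longleftrightarrow> lattice_coeffs d vs l" for l
  proof -
    have "(\<forall>j<d + 1. (\<Sum>i\<le>d. l i * (vs i @\<^sub>v vec 1 (\<lambda>_. 1)) $ j) \<in> \<int>)
        \<longleftrightarrow> (\<forall>j<d + 1. (\<Sum>i\<le>d. l i * (if j < d then vs i $ j else 1)) \<in> \<int>)"
      using nth by (simp del: One_nat_def)
    also have "\<dots> \<longleftrightarrow> lattice_coeffs d vs l"
      unfolding lattice_coeffs_def by (auto simp: less_Suc_eq)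
    finally show ?thesis by (simp add: lattice_vecs_def del: One_nat_def)
  qed
  show ?thesis
    unfolding Lambda_def lat
  proof (intro equalityI subsetI)
    fix g assume "g \<in> {\<lambda>i\<in>{..<d + 1}. mod_int (l i) |l. lattice_coeffs d vs l}"
    then obtain l where g: "g = (\<lambda>i\<in>{..<d + 1}. mod_int (l i))" and l: "lattice_coeffs d vs l" by blast
    have "g = (\<lambda>i\<in>{..<d + 1}. mod_int ((\<lambda>i\<in>{..d}. frac (l i)) i))"
      unfolding g by (intro restrict_ext) (auto simp: mod_int_eq_iff frac_def)
    then show "g \<in> (\<lambda>l. \<lambda>i\<in>{..<d + 1}. mod_int (l i)) ` box d vs"
      using frac_in_box[OF S l] by blast
  qed (auto simp: box_def)
qed

lemma diagonal_in_Lambda_iff: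
  assumes S: "lattice_simplex d vs"
  shows "diagonal_point d x \<in> Lambda d vs \<longleftrightarrow> lattice_coeffs d vs (\<lambda>_. x)"
proof
  assume "diagonal_point d x \<in> Lambda d vs"
  then obtain l where l: "l \<in> box d vs" and eq: "diagonal_point d x = (\<lambda>i\<in>{..<d + 1}. mod_int (l i))"
    unfolding Lambda_eq_image_box[OF S] by blast
  have "x - l i \<in> \<int>" if "i \<le> d" for i
    using fun_cong[OF eq, of i] that by (simp add: diagonal_point_def mod_int_eq_iff)
  moreover have "lattice_coeffs d vs l" using l by (simp add: box_def)
  ultimately show "lattice_coeffs d vs (\<lambda>_. x)"
    using lattice_coeffs_mod_Ints[OF S, of l "\<lambda>_. x"] by blast
next
  assume "lattice_coeffs d vs (\<lambda>_. x)"
  from frac_in_box[OF S this]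
  have "(\<lambda>i\<in>{..<d + 1}. mod_int ((\<lambda>i\<in>{..d}. frac x) i)) \<in> Lambda d vs"
    unfolding Lambda_eq_image_box[OF S] by blast
  moreover have "(\<lambda>i\<in>{..<d + 1}. mod_int ((\<lambda>i\<in>{..d}. frac x) i)) = diagonal_point d x"
    unfolding diagonal_point_def by (intro restrict_ext) (auto simp: mod_int_eq_iff frac_def)
  ultimately show "diagonal_point d x \<in> Lambda d vs" by simp
qed

lemma lattice_coeffs_diagonal_mult:
  "lattice_coeffs d vs (\<lambda>_. x) \<Longrightarrow> lattice_coeffs d vs (\<lambda>_. of_int z * x)"
  by (auto simp: lattice_coeffs_def sum_distrib_left[symmetric] mult.assoc mult.left_commute[of _ "of_int z"])

text \<open>
  The multiples of \<open>(1/v, \<dots>, 1/v)\<close> are \<open>v\<close> distinct points of the torus. If one generator lies in \<open>\<Lambda>\<close>,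
  so do all of them, and they exhaust \<open>\<Lambda>\<close> when it has \<open>v\<close> elements.
\<close>

lemma Lambda_eq_generate_iff:
  assumes S: "lattice_simplex d vs" and v: "card (box d vs) = v" "v > 0"
  shows "Lambda d vs = generate (torus (d + 1)) {diagonal_point d (1 / real v)}
    \<longleftrightarrow> lattice_coeffs d vs (\<lambda>_. 1 / real v)"
proof
  assume "Lambda d vs = generate (torus (d + 1)) {diagonal_point d (1 / real v)}"
  then have "diagonal_point d (1 / real v) \<in> Lambda d vs" by (simp only: generate.incl[OF singletonI])
  then show "lattice_coeffs d vs (\<lambda>_. 1 / real v)" using diagonal_in_Lambda_iff[OF S] by blast
next
  assume diag: "lattice_coeffs d vs (\<lambda>_. 1 / real v)"
  let ?h = "\<lambda>z :: int. diagonal_point d (of_int z * (1 / real v))"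
  have gen: "range ?h \<subseteq> Lambda d vs"
    using diagonal_in_Lambda_iff[OF S] lattice_coeffs_diagonal_mult[OF diag] by blast
  have fin: "finite (Lambda d vs)" and card: "card (Lambda d vs) \<le> v"
    unfolding Lambda_eq_image_box[OF S] using finite_box[OF S] card_image_le[OF finite_box[OF S]] v by auto
  have "inj_on ?h {0..<int v}"
  proof (rule inj_onI)
    fix x y :: int assume xy: "x \<in> {0..<int v}" "y \<in> {0..<int v}" and "?h x = ?h y"
    then have "of_int x * (1 / real v) - of_int y * (1 / real v) \<in> \<int>" by (simp only: diagonal_point_eq_iff)
    then obtain z :: int where "of_int x * (1 / real v) - of_int y * (1 / real v) = of_int z" by (elim Ints_cases)
    then have "(real_of_int x - real_of_int y) / real v = of_int z" by (simp add: diff_divide_distrib)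
    then have "real_of_int (x - y) = real_of_int (z * int v)" using v(2) by (simp add: divide_eq_eq)
    then have "x - y = z * int v" by (simp only: of_int_eq_iff)
    moreover have "\<bar>x - y\<bar> < int v" using xy by auto
    ultimately have "\<bar>z\<bar> * int v < 1 * int v" by (simp add: abs_mult)
    then have "\<bar>z\<bar> < 1" using v(2) by (simp only: mult_less_cancel_right)
    then have "z = 0" by simp
    then show "x = y" using \<open>x - y = z * int v\<close> by simp
  qed
  then have "v = card (?h ` {0..<int v})" by (simp add: card_image)
  also have "\<dots> \<le> card (range ?h)"
    by (intro card_mono finite_subset[OF gen fin]) auto
  finally have "range ?h = Lambda d vs"
    using gen card fin by (intro card_seteq) auto
  then show "Lambda d vs = generate (torus (d + 1)) {diagonal_point d (1 / real v)}"
    by (simp only: generate_diagonal_point)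
qed

section \<open>Simplices whose delta polynomial is a geometric sum\<close>

text \<open>
  Comparing coefficients shows that \<open>f\<close> takes each value as often as \<open>g\<close>, so at most once.
\<close>

lemma bij_betw_of_sum_monom_eq:
  assumes A: "finite A" and B: "finite B" and inj: "inj_on g B"
    and eq: "(\<Sum>a\<in>A. monom (1 :: int) (f a)) = (\<Sum>b\<in>B. monom 1 (g b))"
  shows "bij_betw f A (g ` B)"
proof -
  have coeff: "coeff (\<Sum>a\<in>C. monom (1 :: int) (h a)) n = int (card {a\<in>C. h a = n})"
    if "finite C" for C :: "'c set" and h n
    using that by (simp add: coeff_sum sum.If_cases Int_def conj_commute)
  have card: "card {a\<in>A. f a = n} = card {b\<in>B. g b = n}" for n
    using coeff[OF A, of f n] coeff[OF B, of g n] eq by simp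
  have le1: "card {b\<in>B. g b = n} \<le> 1" for n
    using B inj by (auto simp: card_le_Suc0_iff_eq inj_on_def)
  have "inj_on f A"
  proof (rule inj_onI)
    fix x y assume xy: "x \<in> A" "y \<in> A" "f x = f y"
    have "\<forall>a\<in>{a\<in>A. f a = f x}. \<forall>b\<in>{a\<in>A. f a = f x}. a = b"
      using card[of "f x"] le1[of "f x"] A by (subst card_le_Suc0_iff_eq[symmetric]) auto
    then show "x = y" using xy by auto
  qed
  moreover have "n \<in> f ` A \<longleftrightarrow> n \<in> g ` B" for n
  proof -
    have "n \<in> f ` A \<longleftrightarrow> card {a\<in>A. f a = n} \<noteq> 0" using A by auto
    also have "\<dots> \<longleftrightarrow> n \<in> g ` B" unfolding card using B by auto
    finally show ?thesis .
  qed
  ultimately show ?thesis unfolding bij_betw_def by blast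
qed


lemma sum_lessThan_real: "(\<Sum>i<n. real i) = real n * (real n - 1) / 2"
  by (induction n) (simp_all add: field_simps)

lemma box_coordinate_le:
  assumes S: "lattice_simplex d vs" and v: "card (box d vs) = v" and l: "l \<in> box d vs" and i: "i \<le> d"
  shows "l i \<le> 1 - 1 / real v"
proof -
  have v0: "v > 0" using finite_box[OF S] l v by (auto simp: card_gt_0_iff)
  obtain z :: int where z: "real v * l i = of_int z"
    using card_box_mult_coordinate_Ints[OF S l i] v by (auto elim: Ints_cases)
  have "real v * l i < real v * 1" using box_bounds[OF l i] v0 by (intro mult_strict_left_mono) auto
  then have "real_of_int z < real_of_int (int v)" using z by simp
  then have "z \<le> int v - 1" by (simp only: of_int_less_iff)
  then have "real_of_int z \<le> real v - 1" by linarith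
  then have "real v * l i \<le> real v * (1 - 1 / real v)" using z v0 by (simp add: right_diff_distrib)
  then show ?thesis using v0 by simp
qed

context
  fixes d v k :: nat and vs :: "nat \<Rightarrow> real vec"
  assumes S: "lattice_simplex d vs"
    and \<delta>: "has_delta_polynomial d (simplex d vs) (\<Sum>i<v. monom 1 (i * k))"
    and v: "v \<ge> 1" and k: "k \<ge> 1"
begin

lemma bij_betw_box_heights: "bij_betw (height d) (box d vs) ((\<lambda>i. i * k) ` {..<v})"
proof (rule bij_betw_of_sum_monom_eq[OF finite_box[OF S]])
  show "inj_on (\<lambda>i. i * k) {..<v}" using k by (auto intro: inj_onI)
  show "(\<Sum>l\<in>box d vs. monom 1 (height d l)) = (\<Sum>i<v. monom (1 :: int) (i * k))"
    using \<delta> has_delta_polynomial_simplex_iff[OF S] by blast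
qed simp

lemma card_box: "card (box d vs) = v"
proof -
  have "inj_on (\<lambda>i. i * k) {..<v}" using k by (auto intro: inj_onI)
  then show ?thesis using bij_betw_same_card[OF bij_betw_box_heights] by (simp add: card_image)
qed

lemma height_le: "l \<in> box d vs \<Longrightarrow> height d l \<le> (v - 1) * k"
  using bij_betwE[OF bij_betw_box_heights] by fastforce

lemma obtain_highest_box_point:
  obtains t where "t \<in> box d vs" "(\<Sum>i\<le>d. t i) = (real v - 1) * real k"
proof -
  have "(v - 1) * k \<in> height d ` box d vs"
    using bij_betw_imp_surj_on[OF bij_betw_box_heights] v by auto
  then obtain t where t: "t \<in> box d vs" "height d t = (v - 1) * k" by auto
  then have "(\<Sum>i\<le>d. t i) = (real v - 1) * real k"
    using sum_box_eq_height[OF t(1)] v by (simp add: of_nat_diff)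
  then show thesis using t that by blast
qed

lemma volume_mult_gap_le_Suc_dimension:
  assumes "v \<ge> 2"
  shows "v * k \<le> d + 1"
proof -
  obtain t where t: "t \<in> box d vs" "(\<Sum>i\<le>d. t i) = (real v - 1) * real k" by (rule obtain_highest_box_point)
  have "(real v - 1) * real k \<le> (\<Sum>i\<le>d. 1 - 1 / real v)"
    unfolding t(2)[symmetric] by (intro sum_mono box_coordinate_le[OF S card_box t(1)]) simp
  also have "\<dots> = (real v - 1) * ((real d + 1) / real v)" using v by (simp add: field_simps)
  finally have "real k \<le> (real d + 1) / real v"
    using assms by (subst (asm) mult_le_cancel_left_pos) simp_all
  then have "real (v * k) \<le> real (d + 1)" using v by (simp add: field_simps)
  then show ?thesis by (simp only: of_nat_le_iff)
qed

text \<open>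
  The inequality \<open>(v - 1) k \<le> (d + 1) (1 - 1/v)\<close> for the highest box point is an equality only if every
  coordinate takes the largest possible value \<open>1 - 1/v\<close>, that is, if this point represents \<open>-(1/v, \<dots>, 1/v)\<close>.
\<close>

lemma diagonal_iff_dimension:
  assumes v2: "v \<ge> 2"
  shows "lattice_coeffs d vs (\<lambda>_. 1 / real v) \<longleftrightarrow> d + 1 = v * k"
proof
  assume dim: "d + 1 = v * k"
  obtain t where t: "t \<in> box d vs" "(\<Sum>i\<le>d. t i) = (real v - 1) * real k" by (rule obtain_highest_box_point)
  have "(\<Sum>i\<le>d. 1 - 1 / real v - t i) = (real d + 1) * (1 - 1 / real v) - (real v - 1) * real k"
    by (simp add: sum_subtractf t(2))
  also have "real d + 1 = real v * real k" using arg_cong[OF dim, of real] by simp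
  also have "real v * real k * (1 - 1 / real v) - (real v - 1) * real k = 0"
    using v by (simp add: field_simps)
  finally have "\<forall>i\<in>{..d}. 1 - 1 / real v - t i = 0"
    by (subst (asm) sum_nonneg_eq_0_iff) (use box_coordinate_le[OF S card_box t(1)] in auto)
  then have top: "t i = 1 - 1 / real v" if "i \<le> d" for i using that by simp
  have "lattice_coeffs d vs (\<lambda>i. - t i)" using t by (intro lattice_coeffs_uminus) (simp add: box_def)
  then show "lattice_coeffs d vs (\<lambda>_. 1 / real v)"
    by (rule lattice_coeffs_mod_Ints[OF S]) (simp add: top)
next
  assume "lattice_coeffs d vs (\<lambda>_. 1 / real v)"
  then have "lattice_coeffs d vs (\<lambda>_. - (1 / real v))" by (rule lattice_coeffs_uminus)
  then have b: "(\<lambda>i\<in>{..d}. frac (- (1 / real v))) \<in> box d vs" by (rule frac_in_box[OF S])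
  have "\<lfloor>- (1 / real v)\<rfloor> = - 1" using v by (simp add: floor_eq_iff)
  then have "(\<Sum>i\<le>d. (\<lambda>i\<in>{..d}. frac (- (1 / real v))) i) = (real d + 1) * (1 - 1 / real v)"
    by (simp add: frac_def)
  then have "(real d + 1) * (1 - 1 / real v) \<le> real ((v - 1) * k)"
    using sum_box_eq_height[OF b] height_le[OF b] by (simp del: of_nat_mult)
  then have "(real v - 1) * ((real d + 1) / real v) \<le> (real v - 1) * real k"
    using v by (simp add: of_nat_diff field_simps)
  then have "(real d + 1) / real v \<le> real k"
    using v2 by (subst (asm) mult_le_cancel_left_pos) simp_all
  then have "real (d + 1) \<le> real (v * k)" using v by (simp add: field_simps)
  then have "d + 1 \<le> v * k" by (simp only: of_nat_le_iff)
  then show "d + 1 = v * k" using volume_mult_gap_le_Suc_dimension[OF v2] by simp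
qed

text \<open>
  Double counting of the sum of all coordinates of all box points: by points it is the sum of the heights,
  by coordinates it is at least \<open>(d + 1) v / 4\<close>.
\<close>

lemma Suc_dimension_le:
  assumes cov: "\<And>i. i \<le> d \<Longrightarrow> \<exists>l\<in>box d vs. l i \<noteq> 0"
  shows "d + 1 \<le> 2 * (v - 1) * k"
proof -
  have "(real d + 1) * real v = (\<Sum>i\<le>d. real (card (box d vs)))" by (simp add: card_box)
  also have "\<dots> \<le> (\<Sum>i\<le>d. 4 * (\<Sum>l\<in>box d vs. l i))"
    using cov card_box_le_sum_coordinate[OF S] by (intro sum_mono) auto
  also have "\<dots> = 4 * (\<Sum>l\<in>box d vs. \<Sum>i\<le>d. l i)"
    unfolding sum_distrib_left[symmetric] by (subst sum.swap) simp
  also have "(\<Sum>l\<in>box d vs. \<Sum>i\<le>d. l i) = (\<Sum>l\<in>box d vs. real (height d l))"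
    by (intro sum.cong refl sum_box_eq_height)
  also have "\<dots> = (\<Sum>n\<in>(\<lambda>i. i * k) ` {..<v}. real n)"
    by (rule sum.reindex_bij_betw[OF bij_betw_box_heights])
  also have "\<dots> = (\<Sum>i<v. real i) * real k"
    using k by (subst sum.reindex) (auto intro: inj_onI simp: sum_distrib_right)
  finally have "(real d + 1) * real v \<le> 2 * (real v - 1) * real k * real v"
    by (simp add: sum_lessThan_real field_simps)
  then have "real (d + 1) \<le> real (2 * (v - 1) * k)" using v by (simp add: of_nat_diff)
  then show ?thesis by (simp only: of_nat_le_iff)
qed

lemma dimension_bounds_nonpyramid:
  assumes np: "\<not> lattice_pyramid d (simplex d vs)"
  shows "int v * int k - 1 \<le> int d" (is ?lower)
    and "int d \<le> 4 * (int v - 1) * int k - 2" (is ?upper)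
    and "int d = int v * int k - 1 \<longleftrightarrow>
      Lambda d vs = generate (torus (d + 1)) {\<lambda>i\<in>{..<d + 1}. mod_int (1 / real v)}" (is ?iff)
proof -
  have d: "d > 0" using np by (auto simp: lattice_pyramid_def)
  have cov: "\<exists>l\<in>box d vs. l i \<noteq> 0" if "i \<le> d" for i
    using lattice_pyramid_if_coordinate_vanishes[OF S d that] np by blast
  have v2: "v \<ge> 2"
  proof (rule ccontr)
    assume "\<not> v \<ge> 2"
    then have "card (box d vs) = 1" using v card_box by simp
    moreover have "(\<lambda>i\<in>{..d}. 0) \<in> box d vs" by (simp add: box_def lattice_coeffs_def)
    ultimately have "box d vs = {\<lambda>i\<in>{..d}. 0}" by (metis card_1_singletonE singletonD)
    then show False using cov[of 0] by simp
  qed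
  have "v * k \<le> d + 1" by (rule volume_mult_gap_le_Suc_dimension[OF v2])
  then have "int (v * k) \<le> int (d + 1)" by (simp only: of_nat_le_iff)
  then show ?lower by simp
  have "d + 1 \<le> 2 * (v - 1) * k" using cov by (rule Suc_dimension_le)
  then have "int (d + 1) \<le> int (2 * (v - 1) * k)" by (simp only: of_nat_le_iff)
  moreover have "int (2 * (v - 1) * k) = 2 * ((int v - 1) * int k)"
    unfolding of_nat_mult of_nat_diff[OF v] by (simp add: algebra_simps)
  ultimately have "int (d + 1) \<le> 2 * ((int v - 1) * int k)" by (rule ord_le_eq_trans)
  then have "int d + 1 \<le> 2 * ((int v - 1) * int k)" by simp
  moreover have "1 * 1 \<le> (int v - 1) * int k" using v2 k by (intro mult_mono) auto
  ultimately show ?upper by linarith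
  have "int d = int v * int k - 1 \<longleftrightarrow> int (d + 1) = int (v * k)" by auto
  also have "\<dots> \<longleftrightarrow> lattice_coeffs d vs (\<lambda>_. 1 / real v)"
    using diagonal_iff_dimension[OF v2] by (simp only: of_nat_eq_iff)
  finally show ?iff
    using Lambda_eq_generate_iff[OF S card_box] v by (simp add: diagonal_point_def)
qed

end

section \<open>Reflexive and Gorenstein simplices\<close>

lemma biorthogonal_commute:
  assumes "\<And>i. i \<le> d \<Longrightarrow> q i \<in> carrier_vec d" "\<And>i. i \<le> d \<Longrightarrow> u i \<in> carrier_vec d"
    and "\<And>i j. i \<le> d \<Longrightarrow> j \<le> d \<Longrightarrow> u i \<bullet> q j = (if i = j then - real d else 1)"
    and "i \<le> d" "j \<le> d"
  shows "q i \<bullet> u j = (if i = j then - real d else 1)"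
  using assms comm_scalar_prod[of "q i" d "u j"] by simp

text \<open>
  The vectors \<open>(- u i, 1)\<close> are, up to the factor \<open>d + 1\<close>, the dual basis of the \<open>(q j, 1)\<close>. So the
  barycentric coordinates of \<open>x\<close> are \<open>(1 - u i \<bullet> x)/(d + 1)\<close>, and the inequalities say that
  they are nonnegative.
\<close>

lemma mem_simplex_if_dual_inequalities:
  assumes q: "\<And>i. i \<le> d \<Longrightarrow> q i \<in> carrier_vec d" and u: "\<And>i. i \<le> d \<Longrightarrow> u i \<in> carrier_vec d"
    and uq: "\<And>i j. i \<le> d \<Longrightarrow> j \<le> d \<Longrightarrow> u i \<bullet> q j = (if i = j then - real d else 1)"
    and x: "x \<in> carrier_vec d" and ux: "\<And>i. i \<le> d \<Longrightarrow> u i \<bullet> x \<le> 1"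
  shows "x \<in> simplex d q"
proof -
  define Q where "Q = mat (Suc d) (Suc d) (\<lambda>(r, c). if r < d then q c $ r else 1)"
  define W where "W = mat (Suc d) (Suc d) (\<lambda>(r, c). (if c < d then - u r $ c else 1) / (real d + 1))"
  have Q: "Q \<in> carrier_mat (Suc d) (Suc d)" and W: "W \<in> carrier_mat (Suc d) (Suc d)"
    by (simp_all add: Q_def W_def)
  have sp: "u i \<bullet> y = (\<Sum>s<d. u i $ s * y $ s)" if "i \<le> d" "y \<in> carrier_vec d" for i y
    using that u by (simp add: scalar_prod_def lessThan_atLeast0)
  have "W * Q = 1\<^sub>m (Suc d)"
  proof (rule eq_matI)
    fix i j assume "i < dim_row (1\<^sub>m (Suc d) :: real mat)" "j < dim_col (1\<^sub>m (Suc d) :: real mat)"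
    then have ij: "i \<le> d" "j \<le> d" by auto
    have "(W * Q) $$ (i, j) = (\<Sum>s<Suc d. W $$ (i, s) * Q $$ (s, j))"
      using ij by (intro times_mat_index[OF W Q]) simp_all
    also have "\<dots> = (\<Sum>s<d. - (u i $ s * q j $ s) / (real d + 1)) + 1 / (real d + 1)"
      using ij by (simp add: W_def Q_def)
    also have "\<dots> = (1 - u i \<bullet> q j) / (real d + 1)"
      by (simp add: sp[OF ij(1) q[OF ij(2)]] sum_negf sum_divide_distrib[symmetric] diff_divide_distrib)
    also have "\<dots> = 1\<^sub>m (Suc d) $$ (i, j)" using uq[OF ij] ij by simp
    finally show "(W * Q) $$ (i, j) = 1\<^sub>m (Suc d) $$ (i, j)" .
  qed (use W Q in simp_all)
  then have QW: "Q * W = 1\<^sub>m (Suc d)" by (rule mat_mult_left_right_inverse[OF W Q])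
  define c where "c i = (1 - u i \<bullet> x) / (real d + 1)" for i
  define x' where "x' s = (if s < d then x $ s else 1)" for s
  have c_eq: "c i = (\<Sum>s<Suc d. W $$ (i, s) * x' s)" if i: "i \<le> d" for i
  proof -
    have "(\<Sum>s<Suc d. W $$ (i, s) * x' s) = (\<Sum>s<d. - (u i $ s * x $ s) / (real d + 1)) + 1 / (real d + 1)"
      using i by (simp add: W_def x'_def)
    also have "\<dots> = c i"
      by (simp add: c_def sp[OF i x] sum_negf sum_divide_distrib[symmetric] diff_divide_distrib)
    finally show ?thesis by simp
  qed
  have Qc: "(\<Sum>i\<le>d. Q $$ (r, i) * c i) = x' r" if r: "r \<le> d" for r
  proof -
    have QWr: "(\<Sum>i\<le>d. Q $$ (r, i) * W $$ (i, s)) = (if s = r then 1 else 0)" if "s \<le> d" for s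
      using times_mat_index[OF Q W, of r s] QW r that unfolding lessThan_Suc_atMost by auto
    have "(\<Sum>i\<le>d. Q $$ (r, i) * c i) = (\<Sum>i\<le>d. \<Sum>s\<le>d. Q $$ (r, i) * W $$ (i, s) * x' s)"
      by (intro sum.cong refl) (simp add: c_eq lessThan_Suc_atMost sum_distrib_left mult.assoc)
    also have "\<dots> = (\<Sum>s\<le>d. (\<Sum>i\<le>d. Q $$ (r, i) * W $$ (i, s)) * x' s)"
      unfolding sum_distrib_right by (rule sum.swap)
    also have "\<dots> = (\<Sum>s\<le>d. if s = r then x' s else 0)"
      by (intro sum.cong refl) (simp add: QWr)
    finally show ?thesis using r by simp
  qed
  have "x = comb d q c"
  proof (rule eq_vecI)
    fix r assume "r < dim_vec (comb d q c)"
    then have r: "r < d" by simp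
    then show "x $ r = comb d q c $ r"
      using Qc[of r] by (simp add: Q_def x'_def mult.commute)
  qed (use x in simp)
  moreover have "(\<Sum>i\<le>d. c i) = 1" using Qc[of d] by (simp add: Q_def x'_def)
  moreover have "\<forall>i\<le>d. 0 \<le> c i" using ux by (simp add: c_def)
  ultimately show ?thesis unfolding simplex_eq_combinations by blast
qed

text \<open>
  The relation between \<open>q\<close> and \<open>u\<close> is symmetric, which makes the simplices with these vertices dual to each
  other.
\<close>

lemma reflexive_polytope_simplex:
  assumes ql: "\<And>i. i \<le> d \<Longrightarrow> q i \<in> lattice_vecs d" and ul: "\<And>i. i \<le> d \<Longrightarrow> u i \<in> lattice_vecs d"
    and uq: "\<And>i j. i \<le> d \<Longrightarrow> j \<le> d \<Longrightarrow> u i \<bullet> q j = (if i = j then - real d else 1)"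
  shows "reflexive_polytope d (simplex d q)"
proof -
  have q: "q i \<in> carrier_vec d" and u: "u i \<in> carrier_vec d" if "i \<le> d" for i
    using ql ul that by (auto simp: lattice_vecs_def)
  have qu: "q i \<bullet> u j = (if i = j then - real d else 1)" if "i \<le> d" "j \<le> d" for i j
    using q u uq that by (rule biorthogonal_commute)
  have dual: "dual_polytope d (simplex d q) = simplex d u"
  proof (intro equalityI subsetI)
    fix y assume y: "y \<in> dual_polytope d (simplex d q)"
    then have yc: "y \<in> carrier_vec d" by (simp add: dual_polytope_def)
    have "q i \<bullet> y \<le> 1" if "i \<le> d" for i
      using y vertex_in_simplex[of i d q, OF that q[OF that]] comm_scalar_prod[OF q[OF that] yc]
      by (simp add: dual_polytope_def)
    then show "y \<in> simplex d u"
      using mem_simplex_if_dual_inequalities[OF u q qu yc] by blast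
  next
    fix y assume "y \<in> simplex d u"
    then obtain b where b: "\<forall>i\<le>d. 0 \<le> b i" "(\<Sum>i\<le>d. b i) = 1" and y: "y = comb d u b"
      unfolding simplex_eq_combinations by auto
    have yq: "y \<bullet> q j \<le> 1" if j: "j \<le> d" for j
    proof -
      have "y \<bullet> q j = (\<Sum>i\<le>d. b i * (q j \<bullet> u i))"
        unfolding y using comm_scalar_prod[of "comb d u b" d "q j"] scalar_prod_comb[OF q[OF j] u] q[OF j]
        by simp
      also have "\<dots> \<le> (\<Sum>i\<le>d. b i * 1)"
        using b qu[OF j] by (intro sum_mono mult_left_mono) auto
      finally show ?thesis using b by simp
    qed
    have "y \<bullet> x \<le> 1" if xq: "x \<in> simplex d q" for x
    proof -
      obtain c where c: "\<forall>i\<le>d. 0 \<le> c i" "(\<Sum>i\<le>d. c i) = 1" and x: "x = comb d q c"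
        using xq unfolding simplex_eq_combinations by auto
      have "y \<bullet> x = (\<Sum>i\<le>d. c i * (y \<bullet> q i))"
        unfolding x using q by (intro scalar_prod_comb) (simp_all add: y)
      also have "\<dots> \<le> (\<Sum>i\<le>d. c i * 1)"
        using c yq by (intro sum_mono mult_left_mono) auto
      finally show ?thesis using c by simp
    qed
    then show "y \<in> dual_polytope d (simplex d q)" by (simp add: dual_polytope_def y)
  qed
  \<comment> \<open>The ball of radius \<open>1/B\<close> around the origin satisfies all the inequalities \<open>u i \<bullet> y \<le> 1\<close>.\<close>
  define B where "B = 1 + (\<Sum>i\<le>d. \<Sum>s<d. \<bar>u i $ s\<bar>)"
  have B: "B \<ge> 1" unfolding B_def by (simp add: sum_nonneg)
  have "y \<in> simplex d q" if y: "y \<in> carrier_vec d" and small: "(y - 0\<^sub>v d) \<bullet> (y - 0\<^sub>v d) < (1 / B)\<^sup>2" for y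
  proof (rule mem_simplex_if_dual_inequalities[OF q u uq y])
    fix i assume i: "i \<le> d"
    have y0: "y - 0\<^sub>v d = y" using y by (intro eq_vecI) auto
    have coord: "\<bar>y $ s\<bar> \<le> 1 / B" if s: "s < d" for s
    proof -
      have "(y $ s)\<^sup>2 \<le> (\<Sum>s<d. (y $ s)\<^sup>2)" using s by (intro member_le_sum) auto
      also have "\<dots> = y \<bullet> y" using y by (simp add: scalar_prod_def lessThan_atLeast0 power2_eq_square)
      also have "\<dots> < (1 / B)\<^sup>2" using small by (simp only: y0)
      finally have "\<bar>y $ s\<bar>\<^sup>2 < (1 / B)\<^sup>2" by simp
      then have "\<bar>y $ s\<bar> < 1 / B" by (rule power2_less_imp_less) (use B in simp)
      then show ?thesis by simp
    qed
    have "u i \<bullet> y = (\<Sum>s<d. u i $ s * y $ s)" using y by (simp add: scalar_prod_def lessThan_atLeast0)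
    also have "\<dots> \<le> (\<Sum>s<d. \<bar>u i $ s\<bar> * (1 / B))"
    proof (rule sum_mono)
      fix s assume "s \<in> {..<d}"
      then have "\<bar>u i $ s * y $ s\<bar> \<le> \<bar>u i $ s\<bar> * (1 / B)"
        unfolding abs_mult using coord[of s] by (intro mult_left_mono) auto
      then show "u i $ s * y $ s \<le> \<bar>u i $ s\<bar> * (1 / B)" by linarith
    qed
    also have "\<dots> = (\<Sum>s<d. \<bar>u i $ s\<bar>) / B" by (simp add: sum_divide_distrib)
    also have "\<dots> \<le> 1"
    proof -
      have "(\<Sum>s<d. \<bar>u i $ s\<bar>) \<le> (\<Sum>i\<le>d. \<Sum>s<d. \<bar>u i $ s\<bar>)"
        by (rule member_le_sum[where f = "\<lambda>i. \<Sum>s<d. \<bar>u i $ s\<bar>"]) (use i in \<open>auto intro: sum_nonneg\<close>)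
      then show ?thesis using B by (simp add: B_def)
    qed
    finally show "u i \<bullet> y \<le> 1" .
  qed
  then have "0\<^sub>v d \<in> interior_pts d (simplex d q)"
    unfolding interior_pts_def using B by (intro CollectI conjI exI[of _ "1 / B"]) auto
  then show ?thesis
    unfolding reflexive_polytope_def dual using ql ul by (simp add: lattice_polytope_simplex)
qed

lemma gorenstein_simplexI:
  assumes r: "r > 0" and vs: "\<And>i. i \<le> d \<Longrightarrow> vs i \<in> carrier_vec d" and w: "w \<in> lattice_vecs d"
    and refl: "reflexive_polytope d (simplex d (\<lambda>i. real r \<cdot>\<^sub>v vs i + w))"
  shows "gorenstein d (simplex d vs)"
  unfolding gorenstein_def
proof (intro exI conjI)
  let ?Q = "simplex d (\<lambda>i. real r \<cdot>\<^sub>v vs i + w)"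
  have wc: "w \<in> carrier_vec d" using w by (simp add: lattice_vecs_def)
  have one: "transpose_mat (map_mat real_of_int (1\<^sub>m d)) = 1\<^sub>m d" by (intro eq_matI) auto
  have sm: "(real r \<cdot>\<^sub>m 1\<^sub>m d) *\<^sub>v x = real r \<cdot>\<^sub>v x" if "x \<in> carrier_vec d" for x
  proof (rule eq_vecI)
    fix i assume "i < dim_vec (real r \<cdot>\<^sub>v x)"
    then have i: "i < d" using that by simp
    have "((real r \<cdot>\<^sub>m 1\<^sub>m d) *\<^sub>v x) $ i = (\<Sum>s<d. (real r \<cdot>\<^sub>m 1\<^sub>m d) $$ (i, s) * x $ s)"
      using that i by (intro mult_mat_vec_index) simp_all
    also have "\<dots> = (\<Sum>s<d. if s = i then real r * x $ s else 0)"
      using i by (intro sum.cong refl) auto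
    finally show "((real r \<cdot>\<^sub>m 1\<^sub>m d) *\<^sub>v x) $ i = (real r \<cdot>\<^sub>v x) $ i"
      using that i by simp
  qed (use that in simp)
  have "?Q = simplex d (\<lambda>i. (real r \<cdot>\<^sub>m 1\<^sub>m d) *\<^sub>v vs i + w)"
    unfolding simplex_def by (intro arg_cong[where f = "conv d"] image_cong) (simp_all add: sm vs)
  also have "\<dots> = (\<lambda>x. (real r \<cdot>\<^sub>m 1\<^sub>m d) *\<^sub>v x + w) ` simplex d vs"
    using vs wc by (intro affine_image_simplex[symmetric]) simp_all
  also have "\<dots> = (\<lambda>x. transpose_mat (map_mat real_of_int (1\<^sub>m d)) *\<^sub>v x + w) ` dilate r (simplex d vs)"
    unfolding dilate_def image_image one
    by (intro image_cong refl) (auto simp: simplex_eq_combinations sm)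
  finally show "unimodularly_equivalent d (dilate r (simplex d vs)) ?Q"
    unfolding unimodularly_equivalent_def using w
    by (intro exI[of _ "1\<^sub>m d"] exI[of _ w]) simp
qed (use r refl in simp_all)


section \<open>A Gorenstein simplex with a diagonal group\<close>

context
  fixes d L v k :: nat
  assumes dL: "d = Suc L" and dim: "v * k = Suc d"
begin

text \<open>
  A simplex whose vertices satisfy \<open>(\<Sum>i\<le>d. diag_vertex i) = v e\<^sub>L\<close>, so that \<open>1/v\<close> times the sum of all
  \<open>(diag_vertex i, 1)\<close> is the lattice point \<open>(e\<^sub>L, k)\<close>.
\<close>

definition diag_vertex :: "nat \<Rightarrow> real vec" where
  "diag_vertex i = vec d (\<lambda>j. if i < L then (if j = i then 1 else 0)
     else if i = L then (if j = L then real v else - 1) else 0)"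

text \<open>
  With \<open>c i\<close> the \<open>i\<close>-th barycentric coordinate on the \<open>k\<close>-th dilate of the simplex, an affine function
  with value \<open>1/v\<close> at \<open>e\<^sub>L\<close>, this is \<open>- v\<close> times the linear part of \<open>c i\<close>.
\<close>

definition dual_vertex :: "nat \<Rightarrow> real vec" where
  "dual_vertex i = vec d (\<lambda>j. if i < L then (if j = i then - real v else if j = L then - 1 else 0)
     else if i = L then (if j = L then - 1 else 0) else (if j = L then real d else real v))"

lemma index_cases:
  "j < d \<longleftrightarrow> j < L \<or> j = L" "i \<le> d \<longleftrightarrow> i < L \<or> i = L \<or> i = d" "d \<noteq> L" "L \<noteq> d" "\<not> d < L"
  using dL by auto

lemma factors_positive: "v > 0" "k > 0"
  using dim by (auto intro: Nat.gr0I)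

lemma real_dim: "real v * real k = real d + 1"
  using arg_cong[OF dim, of real] by simp

lemma sum_diag_vertex:
  assumes j: "j < d"
  shows "(\<Sum>i\<le>d. c i * diag_vertex i $ j) = (if j = L then real v * c L else c j - c L)"
proof -
  have "(\<Sum>i\<le>d. c i * diag_vertex i $ j)
      = (\<Sum>i\<le>d. if i = L then (if j = L then real v * c L else - c L) else 0)
        + (\<Sum>i\<le>d. if i = j then (if j = L then 0 else c j) else 0)"
    unfolding sum.distrib[symmetric] using j by (intro sum.cong refl) (auto simp: diag_vertex_def index_cases)
  also have "\<dots> = (if j = L then real v * c L else c j - c L)"
  proof -
    have "j \<le> d" "L \<le> d" using j dL by simp_all
    then show ?thesis by simp
  qed
  finally show ?thesis .
qed

lemma lattice_simplex_diag_vertex: "lattice_simplex d diag_vertex"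
  unfolding lattice_simplex_def
proof (intro conjI allI impI)
  show "diag_vertex i \<in> lattice_vecs d" for i by (auto simp: lattice_vecs_def diag_vertex_def)
  fix c i assume c: "sum c {..d} = 0 \<and> vec d (\<lambda>j. \<Sum>i\<le>d. c i * diag_vertex i $ j) = 0\<^sub>v d" and i: "i \<le> d"
  have zero: "(\<Sum>i\<le>d. c i * diag_vertex i $ j) = 0" if "j < d" for j
    using arg_cong[OF conjunct2[OF c], of "\<lambda>x. x $ j"] that by simp
  have L: "c L = 0" using zero[of L] sum_diag_vertex[of L c] factors_positive by (simp add: index_cases)
  have lt: "c j = 0" if "j < d" for j
    using zero[OF that] sum_diag_vertex[OF that, of c] L by (cases "j = L") auto
  have "sum c {..d} = sum c {..<d} + c d" by (simp add: lessThan_Suc_atMost[symmetric])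
  then have "c d = 0" using c lt by simp
  then show "c i = 0" using lt i by (cases "i = d") auto
qed

lemma box_diag_vertex: "box d diag_vertex = (\<lambda>a. \<lambda>i\<in>{..d}. real a / real v) ` {..<v}"
proof (intro equalityI subsetI)
  fix l assume l: "l \<in> box d diag_vertex"
  then have lc: "lattice_coeffs d diag_vertex l" by (simp add: box_def)
  have eqI: "x = y" if "x - y \<in> \<int>" "0 \<le> x \<and> x < 1" "0 \<le> y \<and> y < 1" for x y :: real
  proof -
    obtain z :: int where z: "x - y = of_int z" using \<open>x - y \<in> \<int>\<close> by (rule Ints_cases)
    then have "\<bar>z\<bar> < 1" using that by linarith
    then show ?thesis using z by simp
  qed
  have lt: "l j = l L" if "j < d" for j
    using lc that sum_diag_vertex[OF that, of l] box_bounds[OF l]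
    by (cases "j = L") (auto simp: lattice_coeffs_def index_cases intro!: eqI)
  have "real v * l L \<in> \<int>" using lc sum_diag_vertex[of L l] by (auto simp: lattice_coeffs_def index_cases)
  then obtain z :: int where z: "real v * l L = of_int z" by (rule Ints_cases)
  have "sum l {..d} = sum l {..<d} + l d" by (simp add: lessThan_Suc_atMost[symmetric])
  also have "sum l {..<d} = real d * l L" using lt by simp
  finally have "sum l {..d} = real d * l L + l d" .
  moreover have "of_int (z * int k) = (real d + 1) * l L"
    unfolding real_dim[symmetric] by (simp add: z[symmetric])
  ultimately have "sum l {..d} - of_int (z * int k) = l d - l L"
    by (simp add: algebra_simps)
  moreover have "sum l {..d} - of_int (z * int k) \<in> \<int>"
    using lc unfolding lattice_coeffs_def by (intro Ints_diff Ints_of_int) simp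
  ultimately have "l d = l L"
    using box_bounds[OF l] by (intro eqI) (simp_all add: index_cases)
  then have all: "l i = l L" if "i \<le> d" for i using lt that by (cases "i = d") auto
  have L: "0 \<le> l L \<and> l L < 1" using box_bounds[OF l, of L] by (simp add: index_cases)
  then have "real v * l L < real v * 1" using factors_positive by (intro mult_strict_left_mono) auto
  moreover have "0 \<le> real v * l L" using L by simp
  ultimately have zb: "0 \<le> z" "z < int v" unfolding z by simp_all
  have "l L = real (nat z) / real v" using z zb factors_positive by (simp add: field_simps)
  then have "l = (\<lambda>i\<in>{..d}. real (nat z) / real v)"
    using l all by (intro extensionalityI[of l "{..d}"]) (auto simp: box_def PiE_def)
  then show "l \<in> (\<lambda>a. \<lambda>i\<in>{..d}. real a / real v) ` {..<v}"
    by (rule image_eqI) (use zb in auto)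
next
  fix l assume "l \<in> (\<lambda>a. \<lambda>i\<in>{..d}. real a / real v) ` {..<v}"
  then obtain a where a: "a < v" and l: "l = (\<lambda>i\<in>{..d}. real a / real v)" by auto
  have "sum l {..d} = real a * ((real d + 1) / real v)" by (simp add: l)
  also have "\<dots> = real (a * k)" unfolding real_dim[symmetric] using factors_positive by simp
  finally have "sum l {..d} \<in> \<int>" by simp
  moreover have "(\<Sum>i\<le>d. l i * diag_vertex i $ j) \<in> \<int>" if "j < d" for j
  proof -
    have "j \<le> d" "L \<le> d" using that dL by simp_all
    then show ?thesis unfolding sum_diag_vertex[OF that] using factors_positive by (simp add: l)
  qed
  ultimately show "l \<in> box d diag_vertex"
    using a by (auto simp: box_def lattice_coeffs_def l)
qed

lemma delta_polynomial_diag_vertex: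
  "has_delta_polynomial d (simplex d diag_vertex) (\<Sum>i<v. monom 1 (i * k))"
proof -
  have ht: "height d (\<lambda>i\<in>{..d}. real a / real v) = a * k" for a
  proof -
    have "(\<Sum>i\<le>d. (\<lambda>i\<in>{..d}. real a / real v) i) = real a * ((real d + 1) / real v)" by simp
    also have "\<dots> = real (a * k)" unfolding real_dim[symmetric] using factors_positive by simp
    finally show ?thesis by (simp add: height_def del: of_nat_mult)
  qed
  have "inj_on (\<lambda>a. \<lambda>i\<in>{..d}. real a / real v) {..<v}"
  proof (rule inj_onI)
    fix a b assume "(\<lambda>i\<in>{..d}. real a / real v) = (\<lambda>i\<in>{..d}. real b / real v)"
    from fun_cong[OF this, of 0] show "a = b" using factors_positive by simp
  qed
  then show ?thesis
    unfolding has_delta_polynomial_simplex_iff[OF lattice_simplex_diag_vertex] box_diag_vertex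
    by (simp add: sum.reindex ht)
qed

lemma gorenstein_diag_vertex: "gorenstein d (simplex d diag_vertex)"
proof (rule gorenstein_simplexI[OF factors_positive(2)])
  let ?w = "- unit_vec d L :: real vec"
  define q where "q i = real k \<cdot>\<^sub>v diag_vertex i + ?w" for i
  show "diag_vertex i \<in> carrier_vec d" for i by (simp add: diag_vertex_def)
  show "?w \<in> lattice_vecs d" by (auto simp: lattice_vecs_def unit_vec_def)
  have q_nth: "q j $ s = (if j < L then (if s = j then real k else if s = L then - 1 else 0)
      else if j = L then (if s = L then real d else - real k) else (if s = L then - 1 else 0))"
    if "s < d" for j s
    using that real_dim by (auto simp: q_def diag_vertex_def unit_vec_def mult.commute)
  have q: "q i \<in> carrier_vec d" for i by (simp add: q_def diag_vertex_def)
  have "reflexive_polytope d (simplex d q)"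
  proof (rule reflexive_polytope_simplex[where u = dual_vertex])
    show "q i \<in> lattice_vecs d" for i using q_nth q[of i] by (auto simp: lattice_vecs_def)
    show "dual_vertex i \<in> lattice_vecs d" for i by (auto simp: lattice_vecs_def dual_vertex_def)
    fix i j assume i: "i \<le> d" and j: "j \<le> d"
    have "dual_vertex i \<bullet> q j = (\<Sum>s<L. dual_vertex i $ s * q j $ s) + dual_vertex i $ L * q j $ L"
    proof -
      have "dual_vertex i \<bullet> q j = (\<Sum>s<d. dual_vertex i $ s * q j $ s)"
        using carrier_vecD[OF q[of j]] by (simp add: scalar_prod_def lessThan_atLeast0)
      also have "{..<d} = insert L {..<L}" using index_cases by auto
      finally show ?thesis by simp
    qed
    also have "(\<Sum>s<L. dual_vertex i $ s * q j $ s)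
        = (\<Sum>s<L. (if i < L then (if s = i then - real v else 0) else if i = L then 0 else real v)
          * (if j < L then (if s = j then real k else 0) else if j = L then - real k else 0))"
      by (intro sum.cong refl) (simp add: q_nth dual_vertex_def index_cases)
    also have "\<dots> = (if i < L then (if j = i then - (real d + 1) else if j = L then real d + 1 else 0)
        else if i = L then 0
        else if j < L then real d + 1 else if j = L then - (real d + 1) * real L else 0)"
      unfolding real_dim[symmetric] by (auto simp: sum_negf if_distrib[of "\<lambda>x. x * _"] if_distrib[of "\<lambda>x. _ * x"] cong: if_cong)
    also have "dual_vertex i $ L = (if i \<le> L then - 1 else real d)"
      by (auto simp: dual_vertex_def index_cases)
    also have "q j $ L = (if j = L then real d else - 1)"
      using q_nth[of L j] by (simp add: index_cases)
    also have "(if i < L then (if j = i then - (real d + 1) else if j = L then real d + 1 else 0)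
        else if i = L then 0
        else if j < L then real d + 1 else if j = L then - (real d + 1) * real L else 0)
        + (if i \<le> L then - 1 else real d) * (if j = L then real d else - 1)
        = (if i = j then - real d else 1)"
      using i j dL by (auto simp: index_cases algebra_simps)
    finally show "dual_vertex i \<bullet> q j = (if i = j then - real d else 1)" .
  qed
  then show "reflexive_polytope d (simplex d (\<lambda>i. real k \<cdot>\<^sub>v diag_vertex i + ?w))"
    by (simp only: q_def[abs_def])
qed

end

lemma ex_gorenstein_simplex_geometric_delta:
  assumes v: "v \<ge> 1" and k: "k \<ge> 1"
  shows "\<exists>d vs. lattice_simplex d vs \<and> gorenstein d (simplex d vs) \<and>
    has_delta_polynomial d (simplex d vs) (\<Sum>i<v. monom 1 (i * k))"
proof -
  \<comment> \<open>For \<open>v = 1\<close> the polynomial is \<open>1\<close> for every \<open>k\<close>; the choice \<open>2\<close> makes the dimension positive.\<close>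
  define k' where "k' = (if v = 1 then 2 else k)"
  have "1 * 2 \<le> v * k'" 
  proof (cases "v = 1")
    case False
    then have "2 * 1 \<le> v * k" using v k by (intro mult_le_mono) auto
    then show ?thesis using False by (simp add: k'_def)
  qed (simp add: k'_def)
  then obtain L where L: "v * k' = Suc (Suc L)" by (metis One_nat_def add_2_eq_Suc le_Suc_ex mult_1 )
  have \<delta>: "(\<Sum>i<v. monom (1 :: int) (i * k')) = (\<Sum>i<v. monom 1 (i * k))"
    by (auto simp: k'_def)
  show ?thesis
    using lattice_simplex_diag_vertex[OF refl L] gorenstein_diag_vertex[OF refl L]
      delta_polynomial_diag_vertex[OF refl L] unfolding \<delta> by blast
qed

theorem proposition2p1:
  fixes v k :: nat
  assumes "v \<ge> 1" and "k \<ge> 1"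
  shows "(\<exists>d vs. lattice_simplex d vs \<and> gorenstein d (simplex d vs) \<and>
            has_delta_polynomial d (simplex d vs) (\<Sum>i<v. monom 1 (i * k))) \<and>
         (\<forall>d vs. lattice_simplex d vs \<and> gorenstein d (simplex d vs) \<and>
            has_delta_polynomial d (simplex d vs) (\<Sum>i<v. monom 1 (i * k)) \<and>
            \<not> lattice_pyramid d (simplex d vs) \<longrightarrow>
              int v * int k - 1 \<le> int d \<and>
              int d \<le> 4 * (int v - 1) * int k - 2 \<and>
              (int d = int v * int k - 1 \<longleftrightarrow>
                 Lambda d vs = generate (torus (d + 1)) {\<lambda>i\<in>{..<d + 1}. mod_int (1 / real v)}))"
  using ex_gorenstein_simplex_geometric_delta[OF assms] dimension_bounds_nonpyramid assms by blast

end
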